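(* Let $X=(W,Q,\pi,I)$ be a root independent irreducible quadruple (an object of $\mathscr D$). When (the underlying graph of) $\Gamma_X$ is a tree, the pair $(\mathcal M,\mathcal P)$ of classes of admissible monomorphisms and admissible epimorphisms defines a proto-exact structure on the subquiver category $\mathcal S_X$.
   Context: Quadruples. For a Coxeter group $W$ of finite rank with simple reflections $s_1,\dots,s_n$, let $V$ be the real vector space with basis the simple roots $\alpha_1,\dots,\alpha_n$, with the form $\langle\alpha_i,\alpha_j\rangle=-\cos(\pi/\operatorname{ord}(s_is_j))$ and the usual geometric action of $W$. Write $[m]=\{1,\dots,m\}$. For a word $Q=s_{i_1}\cdots s_{i_m}$ and $\pi\in W$, the subword complex $\mathcal{SC}_W(Q,\pi)$ has as faces the subsets $I\subseteq[m]$ such that the subword of $Q$ at positions $[m]\setminus I$ contains a reduced expression of $\pi$. A quadruple is $X=(W,Q,\pi,I)$ with $I$ a maximal face of $\mathcal{SC}_W(Q,\pi)$. The root function is $r(l)=\big(\prod_{j\in[l-1]\setminus I}s_{i_j}\big)(\alpha_{i_l})$, $l\in[m]$ (product in increasing order of $j$). $X$ is irreducible if $\{r(i)\}_{i\in I}$ spans $V$; it is moreover root independent if $\{r(i)\}_{i\in I}$ is a basis of $V$. Root configuration quiver. $\Gamma_X$ has vertex set (labelled by) $I$, and there is a (single) arrow $i\to j$ if and only if $(i-j)\cdot\langle r(i),r(j)\rangle>0$. The subobjects of $X$ are indexed by subsets $J\subseteq I$; the subobject $X(J)$ has root configuration quiver $\Gamma_{X(J)}$, identified with the full subquiver of $\Gamma_X$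 on $J$. $\mathcal S_X$: objects are finite disjoint unions $\bigsqcup_{i=1}^t\Gamma_{X(J_i)}$ of labelled quivers, $J_i\subseteq I$ (repetitions allowed); morphisms $A\to B$ are label-preserving partial isomorphisms, i.e. diagrams $A\hookleftarrow P\hookrightarrow B$ given by an $I$-labelled quiver $P$ identified, preserving labels, with a (full) subquiver of $A$ and of $B$; the composite of $A\hookleftarrow P\hookrightarrow B$ and $B\hookleftarrow P'\hookrightarrow C$ is given by the intersection of $P$ and $P'$ in $B$. The disjoint union $\sqcup$ of objects and (componentwise) of morphisms is called direct sum. Admissible morphisms (for $\Gamma_X$ a tree). For $a,b\in I$ put $a\preceq b$ iff there is a path from $b$ to $a$ in $\Gamma_X$. For $J\subseteq H\subseteq I$ the morphism $\tau_{J,H}=(\Gamma_{X(J)}\hookleftarrow\Gamma_{X(J)}\hookrightarrow\Gamma_{X(H)})$ is a basic admissible monomorphism iff for every $a\in J$, $\{b\in H\mid b\preceq a\}\subseteq J$. For $K\subseteq H\subseteq I$ the morphism $\beta_{H,K}=(\Gamma_{X(H)}\hookleftarrow\Gamma_{X(K)}\hookrightarrow\Gamma_{X(K)})$ is a basic admissible epimorphism iff for every $a\in K$, $\{b\in H\mid a\preceq b\}\subseteq K$. $\mathcal M$ (resp. $\mathcal P$) consists of all finite disjoint unions of basic admissible monomorphisms (resp. epimorphisms). Proto-exact category: a category $\mathcal E$ with classes $\mathcal M,\mathcal P$ of morphisms such that: (PE1) $\mathcal E$ has an object $0$ both initial and final, every $0\to A$ is in $\mathcal M$ and every $A\to0$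 is in $\mathcal P$; (PE2) $\mathcal M,\mathcal P$ are closed under composition and contain all isomorphisms; (PE3) a commutative square with $i:A\to B$, $i':C\to D$ in $\mathcal M$ and $j:A\to C$, $j':B\to D$ in $\mathcal P$ is Cartesian iff it is coCartesian; (PE4) any diagram $B\overset{j'}{\to}D\overset{i'}{\leftarrow}C$ with $i'\in\mathcal M$, $j'\in\mathcal P$ can be completed to a biCartesian square as in (PE3) with $i\in\mathcal M$, $j\in\mathcal P$; (PE5) any diagram $C\overset{j}{\leftarrow}A\overset{i}{\to}B$ with $i\in\mathcal M$, $j\in\mathcal P$ can be completed to a biCartesian square as in (PE3) with $i'\in\mathcal M$, $j'\in\mathcal P$. *)

theory Defs
  imports
    "HOL-Analysis.Analysis"
    "HOL-Algebra.Multiplicative_Group"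
    "HOL-Algebra.Group_Action"
    "HOL-Algebra.Generated_Groups"
    "Graph_Theory.Graph_Theory"
begin

section \<open>Coxeter groups and their geometric action\<close>

definition word_prod :: "('w, 'x) monoid_scheme \<Rightarrow> ('n \<Rightarrow> 'w) \<Rightarrow> 'n list \<Rightarrow> 'w" where
  "word_prod W s u = foldr (\<lambda>i x. s i \<otimes>\<^bsub>W\<^esub> x) u \<one>\<^bsub>W\<^esub>"

definition coxeter_matrix :: "('w, 'x) monoid_scheme \<Rightarrow> ('n \<Rightarrow> 'w) \<Rightarrow> 'n \<Rightarrow> 'n \<Rightarrow> nat" where
  "coxeter_matrix W s i j = group.ord W (s i \<otimes>\<^bsub>W\<^esub> s j)"

text \<open>
  The congruence on words generated by \<open>(ij)\<^sup>m = 1\<close> with \<open>m = m\<^sub>i\<^sub>j\<close>.  Since \<open>m\<^sub>i\<^sub>i = 1\<close>, the letters are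
  their own inverses, so the quotient of the free monoid by this congruence is the group
  presented by these relations.  The value \<open>m\<^sub>i\<^sub>j = 0\<close> encodes infinite order; the corresponding
  relation is then the empty one.
\<close>

inductive coxeter_congruence :: "('n \<Rightarrow> 'n \<Rightarrow> nat) \<Rightarrow> 'n list \<Rightarrow> 'n list \<Rightarrow> bool"
  for m :: "'n \<Rightarrow> 'n \<Rightarrow> nat" where
  relation: "coxeter_congruence m (u @ concat (replicate (m i j) [i, j]) @ v) (u @ v)"
| refl: "coxeter_congruence m u u"
| sym: "coxeter_congruence m u v \<Longrightarrow> coxeter_congruence m v u"
| trans: "coxeter_congruence m u v \<Longrightarrow> coxeter_congruence m v w \<Longrightarrow> coxeter_congruence m u w"

text \<open>The simple reflections are indexed by the finite type \<open>'n\<close>, so the rank is \<open>CARD('n)\<close>.\<close>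

locale coxeter_system = group W
  for W :: "('w, 'x) monoid_scheme" (structure) +
  fixes s :: "'n::finite \<Rightarrow> 'w"
  assumes simple_closed: "s i \<in> carrier W"
    and simple_inj: "inj s"
    and simple_ord: "ord (s i) = 2"
    and simple_generate: "generate W (range s) = carrier W"
    and presentation:
      "word_prod W s u = word_prod W s v \<longleftrightarrow> coxeter_congruence (coxeter_matrix W s) u v"

text \<open>
  If \<open>s\<^sub>i s\<^sub>j\<close> has infinite order, then \<open>coxeter_matrix W s i j = 0\<close> and \<open>pi / 0 = 0\<close>, which gives
  the usual value \<open>-cos 0 = -1\<close> of the form.
\<close>

definition coxeter_form ::
  "('w, 'x) monoid_scheme \<Rightarrow> ('n::finite \<Rightarrow> 'w) \<Rightarrow> real ^ 'n \<Rightarrow> real ^ 'n \<Rightarrow> real" where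
  "coxeter_form W s x y =
     (\<Sum>i\<in>UNIV. \<Sum>j\<in>UNIV. x $ i * y $ j * (- cos (pi / real (coxeter_matrix W s i j))))"

definition simple_root :: "'n::finite \<Rightarrow> real ^ 'n" where
  "simple_root i = axis i 1"

definition simple_reflection ::
  "('w, 'x) monoid_scheme \<Rightarrow> ('n::finite \<Rightarrow> 'w) \<Rightarrow> 'n \<Rightarrow> real ^ 'n \<Rightarrow> real ^ 'n" where
  "simple_reflection W s i v = v - (2 * coxeter_form W s v (simple_root i)) *\<^sub>R simple_root i"

definition is_geometric_action ::
  "('w, 'x) monoid_scheme \<Rightarrow> ('n::finite \<Rightarrow> 'w) \<Rightarrow> ('w \<Rightarrow> real ^ 'n \<Rightarrow> real ^ 'n) \<Rightarrow> bool" where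
  "is_geometric_action W s \<rho> \<longleftrightarrow>
     group_action W UNIV \<rho> \<and> (\<forall>i. \<rho> (s i) = simple_reflection W s i)"

text \<open>
  For a Coxeter system such an action exists (lemma \<open>geometric_action_exists\<close> below), and it is
  determined on the carrier because the \<open>s i\<close> generate.
\<close>

definition geometric_action ::
  "('w, 'x) monoid_scheme \<Rightarrow> ('n::finite \<Rightarrow> 'w) \<Rightarrow> 'w \<Rightarrow> real ^ 'n \<Rightarrow> real ^ 'n" where
  "geometric_action W s = (SOME \<rho>. is_geometric_action W s \<rho>)"

context coxeter_system
begin

lemma word_prod_closed: "word_prod W s u \<in> carrier W"
  by (induction u) (auto simp: word_prod_def simple_closed)

lemma word_prod_append: "word_prod W s (u @ v) = word_prod W s u \<otimes> word_prod W s v"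
proof (induction u)
  case Nil
  show ?case using word_prod_closed[of v] by (simp add: word_prod_def)
next
  case (Cons a u)
  then show ?case
    using word_prod_closed[of u] word_prod_closed[of v]
    by (simp add: word_prod_def simple_closed m_assoc)
qed

lemma simple_sq: "s i \<otimes> s i = \<one>"
  using pow_ord_eq_1[OF simple_closed[of i]] simple_closed[of i]
  by (simp add: simple_ord numeral_2_eq_2)

lemma simple_inv: "inv (s i) = s i"
  using simple_sq simple_closed by (simp add: inv_equality)

lemma word_prod_surj:
  assumes "w \<in> carrier W" shows "\<exists>u. word_prod W s u = w"
proof -
  have "w \<in> generate W (range s)" using assms simple_generate by simp
  then show ?thesis
  proof induction
    case one
    show ?case by (rule exI[of _ "[]"]) (simp add: word_prod_def)
  next
    case (incl h)
    then obtain i where "h = s i" by auto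
    then show ?case by (intro exI[of _ "[i]"]) (simp add: word_prod_def simple_closed)
  next
    case (inv h)
    then obtain i where "h = s i" by auto
    then show ?case
      by (intro exI[of _ "[i]"]) (simp add: word_prod_def simple_closed simple_inv)
  next
    case (eng h1 h2)
    then show ?case using word_prod_append by metis
  qed
qed

lemma coxeter_matrix_sym: "coxeter_matrix W s i j = coxeter_matrix W s j i"
proof -
  have "inv (s i \<otimes> s j) = s j \<otimes> s i"
    using simple_closed by (simp add: inv_mult_group simple_inv)
  then show ?thesis
    unfolding coxeter_matrix_def using ord_inv[of "s i \<otimes> s j"] simple_closed by simp
qed

lemma coxeter_matrix_diag: "coxeter_matrix W s i i = 1"
  unfolding coxeter_matrix_def simple_sq by (simp add: ord_eq_1)

lemma coxeter_matrix_ge2: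
  assumes "i \<noteq> j" "coxeter_matrix W s i j \<noteq> 0"
  shows "coxeter_matrix W s i j \<ge> 2"
proof -
  have "coxeter_matrix W s i j \<noteq> 1"
  proof
    assume "coxeter_matrix W s i j = 1"
    then have "s i \<otimes> s j = \<one>"
      using pow_ord_eq_1[of "s i \<otimes> s j"] simple_closed by (simp add: coxeter_matrix_def)
    then have "inv (s j) = s i" using simple_closed by (intro inv_equality) auto
    then show False using simple_inv simple_inj assms(1) by (auto simp: inj_def)
  qed
  then show ?thesis using assms by simp
qed

abbreviation "B \<equiv> coxeter_form W s"
abbreviation "\<alpha> \<equiv> (simple_root :: 'n \<Rightarrow> _)"
abbreviation "\<sigma> \<equiv> simple_reflection W s"

lemma form_linear:
  "B (x + y) z = B x z + B y z" "B (x - y) z = B x z - B y z" "B (r *\<^sub>R x) z = r * B x z"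
  by (simp_all add: coxeter_form_def algebra_simps sum.distrib sum_subtractf sum_distrib_left
      sum_negf)

lemma form_simple: "B (\<alpha> i) (\<alpha> j) = - cos (pi / real (coxeter_matrix W s i j))"
proof -
  have "B (\<alpha> i) (\<alpha> j) = (\<Sum>k\<in>UNIV. \<Sum>l\<in>UNIV. if k = i then
      (if l = j then - cos (pi / real (coxeter_matrix W s k l)) else 0) else 0)"
    unfolding coxeter_form_def simple_root_def by (intro sum.cong) (auto simp: axis_def)
  also have "\<dots> = (\<Sum>k\<in>UNIV. if k = i then
      (\<Sum>l\<in>UNIV. if l = j then - cos (pi / real (coxeter_matrix W s k l)) else 0) else 0)"
    by (intro sum.cong) auto
  finally show ?thesis by simp
qed

lemma refl_linear: "\<sigma> i (x + y) = \<sigma> i x + \<sigma> i y" "\<sigma> i (r *\<^sub>R x) = r *\<^sub>R \<sigma> i x"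
  by (simp_all add: simple_reflection_def form_linear algebra_simps)

lemma refl_invol: "\<sigma> i (\<sigma> i v) = v"
  by (simp add: simple_reflection_def form_linear form_simple coxeter_matrix_diag algebra_simps
      flip: scaleR_add_left)

lemma refl_braid:
  fixes i j :: 'n
  defines "m \<equiv> coxeter_matrix W s i j"
  assumes "i \<noteq> j" "m \<noteq> 0"
  shows "((\<lambda>v. \<sigma> i (\<sigma> j v)) ^^ m) v = v"
proof -
  define \<theta> where "\<theta> = pi / real m"
  define c where "c = cos \<theta>"
  define f where "f = (\<lambda>v. \<sigma> i (\<sigma> j v))"
  have m2: "m \<ge> 2" using assms coxeter_matrix_ge2 by blast
  have \<theta>: "0 < \<theta>" "\<theta> < pi"
    using m2 by (auto simp: \<theta>_def field_simps)
  then have sin: "sin \<theta> > 0" by (rule sin_gt_zero)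
  have Bij: "B (\<alpha> i) (\<alpha> j) = - c" "B (\<alpha> j) (\<alpha> i) = - c" "B (\<alpha> i) (\<alpha> i) = 1" "B (\<alpha> j) (\<alpha> j) = 1"
    using coxeter_matrix_sym[of i j]
    by (simp_all add: form_simple c_def \<theta>_def m_def coxeter_matrix_diag)
  have f_add: "f (x + y) = f x + f y" and f_scale: "f (r *\<^sub>R x) = r *\<^sub>R f x" for x y r
    by (simp_all add: f_def refl_linear)
  have pow_add: "(f ^^ k) (x + y) = (f ^^ k) x + (f ^^ k) y" for k x y
    by (induction k) (simp_all add: f_add)
  have pow_scale: "(f ^^ k) (r *\<^sub>R x) = r *\<^sub>R (f ^^ k) x" for k r x
    by (induction k) (simp_all add: f_scale)
  have fi: "f (\<alpha> i) = (4 * c^2 - 1) *\<^sub>R \<alpha> i + (2 * c) *\<^sub>R \<alpha> j"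
    by (simp add: f_def simple_reflection_def form_linear Bij algebra_simps power2_eq_square
        vec_eq_iff)
  have fj: "f (\<alpha> j) = (- 2 * c) *\<^sub>R \<alpha> i + (- 1) *\<^sub>R \<alpha> j"
    by (simp add: f_def simple_reflection_def form_linear Bij algebra_simps vec_eq_iff)
  have rec: "2 * c * sin t = sin (t + \<theta>) + sin (t - \<theta>)" for t
    by (simp add: c_def sin_add sin_diff)
  have pow: "(f ^^ k) (sin \<theta> *\<^sub>R \<alpha> i) = sin ((2*real k+1)*\<theta>) *\<^sub>R \<alpha> i + sin (2*real k*\<theta>) *\<^sub>R \<alpha> j"
    "(f ^^ k) (sin \<theta> *\<^sub>R \<alpha> j) = (- sin (2*real k*\<theta>)) *\<^sub>R \<alpha> i + (- sin ((2*real k-1)*\<theta>)) *\<^sub>R \<alpha> j" for k :: nat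
  proof (induction k)
    case 0
    { case 1 show ?case by simp }
    { case 2 show ?case by simp }
  next
    case (Suc k)
    have step: "(4*c^2-1) * a - 2*c*b = 2*c*(2*c*a - b) - a" for a b
      by (simp add: power2_eq_square algebra_simps)
    have comb: "f (a *\<^sub>R \<alpha> i + b *\<^sub>R \<alpha> j) = ((4*c^2-1) * a - 2*c*b) *\<^sub>R \<alpha> i + (2*c*a - b) *\<^sub>R \<alpha> j" for a b
      by (simp add: f_add f_scale fi fj algebra_simps)
    have next2: "2*c* sin (t + \<theta>) - sin t = sin (t + 2*\<theta>)" for t
      using rec[of "t + \<theta>"] by (simp add: algebra_simps)
    { case 1
      have A: "2*c* sin ((2*real k+1)*\<theta>) - sin (2*real k*\<theta>) = sin ((2*real k+2)*\<theta>)"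
        using next2[of "2*real k*\<theta>"] by (simp add: algebra_simps)
      have C: "2*c* sin ((2*real k+2)*\<theta>) - sin ((2*real k+1)*\<theta>) = sin ((2*real k+3)*\<theta>)"
        using next2[of "(2*real k+1)*\<theta>"] by (simp add: algebra_simps)
      have "(f ^^ Suc k) (sin \<theta> *\<^sub>R \<alpha> i) = f (sin ((2*real k+1)*\<theta>) *\<^sub>R \<alpha> i + sin (2*real k*\<theta>) *\<^sub>R \<alpha> j)"
        using Suc(1) by simp
      also have "\<dots> = sin ((2*real k+3)*\<theta>) *\<^sub>R \<alpha> i + sin ((2*real k+2)*\<theta>) *\<^sub>R \<alpha> j"
        unfolding comb step A C ..
      finally show ?case by (simp add: algebra_simps) }
    { case 2
      have A: "2*c*(- sin (2*real k*\<theta>)) - (- sin ((2*real k-1)*\<theta>)) = - sin ((2*real k+1)*\<theta>)"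
        using next2[of "(2*real k-1)*\<theta>"] by (simp add: algebra_simps)
      have C: "2*c*(- sin ((2*real k+1)*\<theta>)) - (- sin (2*real k*\<theta>)) = - sin ((2*real k+2)*\<theta>)"
        using next2[of "2*real k*\<theta>"] by (simp add: algebra_simps)
      have "(f ^^ Suc k) (sin \<theta> *\<^sub>R \<alpha> j)
          = f ((- sin (2*real k*\<theta>)) *\<^sub>R \<alpha> i + (- sin ((2*real k-1)*\<theta>)) *\<^sub>R \<alpha> j)"
        using Suc(2) by simp
      also have "\<dots> = (- sin ((2*real k+2)*\<theta>)) *\<^sub>R \<alpha> i + (- sin ((2*real k+1)*\<theta>)) *\<^sub>R \<alpha> j"
        unfolding comb step A C ..
      finally show ?case by (simp add: algebra_simps) }
  qed
  have m\<theta>: "real m * \<theta> = pi" using m2 by (simp add: \<theta>_def)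
  have s0: "sin (2*real m*\<theta>) = 0" "sin ((2*real m+1)*\<theta>) = sin \<theta>" "sin ((2*real m-1)*\<theta>) = - sin \<theta>"
  proof -
    have "2*real m*\<theta> = 2*pi" "(2*real m+1)*\<theta> = \<theta> + 2*pi" "(2*real m-1)*\<theta> = - \<theta> + 2*pi"
      using m\<theta> by (simp_all add: algebra_simps)
    then show "sin (2*real m*\<theta>) = 0" "sin ((2*real m+1)*\<theta>) = sin \<theta>" "sin ((2*real m-1)*\<theta>) = - sin \<theta>"
      by (simp_all only: sin_two_pi sin_periodic sin_minus)
  qed
  have fix_ij: "(f ^^ m) (\<alpha> i) = \<alpha> i" "(f ^^ m) (\<alpha> j) = \<alpha> j"
    using pow[of m] sin by (simp_all only: s0 pow_scale) simp_all
  define a where "a = B v (\<alpha> i)"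
  define b where "b = B v (\<alpha> j)"
  define p where "p = (a + c * b) / (1 - c^2)"
  define q where "q = (b + c * a) / (1 - c^2)"
  define v' where "v' = v - p *\<^sub>R \<alpha> i - q *\<^sub>R \<alpha> j"
  have c1: "1 - c^2 \<noteq> 0" using sin by (simp add: c_def cos_squared_eq)
  have pq: "a - p + q * c = 0" "b + p * c - q = 0"
    using c1 by (simp_all add: p_def q_def field_simps power2_eq_square)
  have v'0: "B v' (\<alpha> i) = 0" "B v' (\<alpha> j) = 0"
    using pq by (simp_all add: v'_def form_linear Bij a_def b_def)
  have "f v' = v'" using v'0 by (simp add: f_def simple_reflection_def)
  then have "(f ^^ m) v' = v'" by (induction m) simp_all
  then have "(f ^^ m) (v' + (p *\<^sub>R \<alpha> i + q *\<^sub>R \<alpha> j)) = v' + (p *\<^sub>R \<alpha> i + q *\<^sub>R \<alpha> j)"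
    by (simp only: pow_add pow_scale fix_ij)
  moreover have "v' + (p *\<^sub>R \<alpha> i + q *\<^sub>R \<alpha> j) = v" by (simp add: v'_def)
  ultimately have "(f ^^ m) v = v" by simp
  then show ?thesis by (simp add: f_def)
qed

definition word_act :: "'n list \<Rightarrow> real ^ 'n \<Rightarrow> real ^ 'n" where
  "word_act u = foldr \<sigma> u"

lemma word_act_append: "word_act (u @ v) = word_act u \<circ> word_act v"
  by (simp add: word_act_def fun_eq_iff)

lemma word_act_replicate:
  "word_act (concat (replicate k [i, j])) = (\<lambda>v. \<sigma> i (\<sigma> j v)) ^^ k"
  by (induction k) (auto simp: word_act_def fun_eq_iff)

lemma word_act_cong:
  assumes "coxeter_congruence (coxeter_matrix W s) u v"
  shows "word_act u = word_act v"
  using assms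
proof induction
  case (relation u i j v)
  have "word_act (concat (replicate (coxeter_matrix W s i j) [i, j])) = id"
  proof (cases "i = j")
    case True
    then show ?thesis
      by (simp add: coxeter_matrix_diag word_act_def fun_eq_iff refl_invol)
  next
    case False
    show ?thesis
      unfolding word_act_replicate fun_eq_iff
      by (cases "coxeter_matrix W s i j = 0") (simp_all add: refl_braid[OF False])
  qed
  then show ?case by (simp add: word_act_append)
qed simp_all

lemma word_act_bij: "bij (word_act u)"
proof (induction u)
  case Nil
  have "word_act [] = id" by (simp add: word_act_def fun_eq_iff)
  then show ?case by (metis bij_id)
next
  case (Cons i u)
  have "bij (\<sigma> i)" by (rule o_bij[of "\<sigma> i"]) (auto simp: fun_eq_iff refl_invol)
  moreover have "word_act (i # u) = \<sigma> i \<circ> word_act u" by (simp add: word_act_def fun_eq_iff)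
  ultimately show ?case using Cons by (metis bij_comp)
qed

lemma geometric_action_exists: "\<exists>\<rho>. is_geometric_action W s \<rho>"
proof
  define \<rho> where "\<rho> w = word_act (SOME u. word_prod W s u = w)" for w
  have \<rho>: "\<rho> (word_prod W s u) = word_act u" for u
    unfolding \<rho>_def using presentation word_act_cong by (metis (mono_tags, lifting) someI)
  have bij: "\<rho> w \<in> carrier (BijGroup UNIV)" for w
    using word_act_bij by (auto simp: BijGroup_def Bij_def \<rho>_def)
  have mult: "\<rho> (x \<otimes> y) = \<rho> x \<otimes>\<^bsub>BijGroup UNIV\<^esub> \<rho> y"
    if xy: "x \<in> carrier W" "y \<in> carrier W" for x y
  proof -
    obtain u v where uv: "x = word_prod W s u" "y = word_prod W s v"
      using word_prod_surj xy by metis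
    have "\<rho> (x \<otimes> y) = word_act u \<circ> word_act v"
      unfolding uv word_prod_append[symmetric] \<rho> word_act_append ..
    also have "\<dots> = \<rho> x \<otimes>\<^bsub>BijGroup UNIV\<^esub> \<rho> y"
      using bij[of x] bij[of y] unfolding uv \<rho>
      by (auto simp: BijGroup_def compose_def fun_eq_iff)
    finally show ?thesis .
  qed
  have "group_action W UNIV \<rho>"
    unfolding group_action_def group_hom_def group_hom_axioms_def hom_def
    using bij mult is_group by (auto simp: group_BijGroup)
  moreover have "\<rho> (s i) = \<sigma> i" for i
    using \<rho>[of "[i]"] simple_closed by (auto simp: word_prod_def word_act_def)
  ultimately show "is_geometric_action W s \<rho>" by (simp add: is_geometric_action_def)
qed

end


section \<open>Quadruples and root configuration quivers\<close>

definition reduced_word :: "('w, 'x) monoid_scheme \<Rightarrow> ('n \<Rightarrow> 'w) \<Rightarrow> 'n list \<Rightarrow> bool" where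
  "reduced_word W s u \<longleftrightarrow> (\<forall>v. word_prod W s v = word_prod W s u \<longrightarrow> length u \<le> length v)"

text \<open>Positions in the word \<open>Q\<close> are counted from 0, that is, \<open>[m]\<close> is rendered as \<open>{..<m}\<close>.\<close>

definition subword_complex ::
  "('w, 'x) monoid_scheme \<Rightarrow> ('n \<Rightarrow> 'w) \<Rightarrow> 'n list \<Rightarrow> 'w \<Rightarrow> nat set set" where
  "subword_complex W s Q p =
     {I. I \<subseteq> {..<length Q} \<and>
         (\<exists>K \<subseteq> {..<length Q} - I. reduced_word W s (nths Q K) \<and> word_prod W s (nths Q K) = p)}"

definition quadruple ::
  "('w, 'x) monoid_scheme \<Rightarrow> ('n::finite \<Rightarrow> 'w) \<Rightarrow> 'n list \<Rightarrow> 'w \<Rightarrow> nat set \<Rightarrow> bool" where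
  "quadruple W s Q p I \<longleftrightarrow>
     coxeter_system W s \<and> p \<in> carrier W \<and>
     I \<in> subword_complex W s Q p \<and> (\<forall>F \<in> subword_complex W s Q p. I \<subseteq> F \<longrightarrow> F = I)"

definition root_function ::
  "('w, 'x) monoid_scheme \<Rightarrow> ('n::finite \<Rightarrow> 'w) \<Rightarrow> 'n list \<Rightarrow> nat set \<Rightarrow> nat \<Rightarrow> real ^ 'n" where
  "root_function W s Q I l =
     geometric_action W s (word_prod W s (nths Q ({..<l} - I))) (simple_root (Q ! l))"

definition irreducible_quadruple ::
  "('w, 'x) monoid_scheme \<Rightarrow> ('n::finite \<Rightarrow> 'w) \<Rightarrow> 'n list \<Rightarrow> nat set \<Rightarrow> bool" where
  "irreducible_quadruple W s Q I \<longleftrightarrow> span (root_function W s Q I ` I) = UNIV"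

text \<open>The roots form a basis as a family indexed by \<open>I\<close>, hence the injectivity requirement.\<close>

definition root_independent ::
  "('w, 'x) monoid_scheme \<Rightarrow> ('n::finite \<Rightarrow> 'w) \<Rightarrow> 'n list \<Rightarrow> nat set \<Rightarrow> bool" where
  "root_independent W s Q I \<longleftrightarrow>
     inj_on (root_function W s Q I) I \<and> independent (root_function W s Q I ` I) \<and>
     span (root_function W s Q I ` I) = UNIV"

definition root_quiver ::
  "('w, 'x) monoid_scheme \<Rightarrow> ('n::finite \<Rightarrow> 'w) \<Rightarrow> 'n list \<Rightarrow> nat set \<Rightarrow> nat pair_pre_digraph" where
  "root_quiver W s Q I =
     \<lparr> pverts = I,
       parcs = {(i, j). i \<in> I \<and> j \<in> I \<and>
         (real i - real j) *
           coxeter_form W s (root_function W s Q I i) (root_function W s Q I j) > 0} \<rparr>"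

text \<open>
  \<^const>\<open>Digraph_Component.tree\<close> is not suitable here: it only excludes directed cycles, and on the
  symmetrised digraph it counts an edge traversed back and forth as a cycle.  An undirected cycle
  is a cycle of the symmetrised digraph of length at least 3.
\<close>

definition underlying_tree :: "'v pair_pre_digraph \<Rightarrow> bool" where
  "underlying_tree G \<longleftrightarrow>
     Digraph_Component.connected (with_proj G) \<and>
     \<not> (\<exists>c. pre_digraph.cycle (with_proj (mk_symmetric (with_proj G))) c \<and> length c \<ge> 3)"


section \<open>Categories and proto-exact structures\<close>

record ('o, 'm) precategory =
  Obj :: "'o set"
  Arr :: "'m set"
  Dom :: "'m \<Rightarrow> 'o"
  Cod :: "'m \<Rightarrow> 'o"
  Id :: "'o \<Rightarrow> 'm"
  Comp :: "'m \<Rightarrow> 'm \<Rightarrow> 'm"  (infixl \<open>\<cdot>\<index>\<close> 70)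

definition Hom :: "('o, 'm) precategory \<Rightarrow> 'o \<Rightarrow> 'o \<Rightarrow> 'm set" where
  "Hom C X Y = {f \<in> Arr C. Dom C f = X \<and> Cod C f = Y}"

locale category =
  fixes C :: "('o, 'm) precategory" (structure)
  assumes dom_cod: "f \<in> Arr C \<Longrightarrow> Dom C f \<in> Obj C \<and> Cod C f \<in> Obj C"
    and id_hom: "X \<in> Obj C \<Longrightarrow> Id C X \<in> Hom C X X"
    and comp_hom: "f \<in> Hom C X Y \<Longrightarrow> g \<in> Hom C Y Z \<Longrightarrow> g \<cdot> f \<in> Hom C X Z"
    and id_left: "f \<in> Hom C X Y \<Longrightarrow> Id C Y \<cdot> f = f"
    and id_right: "f \<in> Hom C X Y \<Longrightarrow> f \<cdot> Id C X = f"
    and assoc: "f \<in> Hom C X Y \<Longrightarrow> g \<in> Hom C Y Z \<Longrightarrow> h \<in> Hom C Z U \<Longrightarrow>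
      (h \<cdot> g) \<cdot> f = h \<cdot> (g \<cdot> f)"

definition zero_object :: "('o, 'm) precategory \<Rightarrow> 'o \<Rightarrow> bool" where
  "zero_object C Z \<longleftrightarrow> Z \<in> Obj C \<and>
     (\<forall>X \<in> Obj C. (\<exists>!f. f \<in> Hom C Z X) \<and> (\<exists>!f. f \<in> Hom C X Z))"

definition is_iso :: "('o, 'm) precategory \<Rightarrow> 'm \<Rightarrow> bool" where
  "is_iso C f \<longleftrightarrow> f \<in> Arr C \<and>
     (\<exists>g \<in> Hom C (Cod C f) (Dom C f).
        g \<cdot>\<^bsub>C\<^esub> f = Id C (Dom C f) \<and> f \<cdot>\<^bsub>C\<^esub> g = Id C (Cod C f))"

text \<open>
  Squares are given by their arrows \<open>i : X \<rightarrow> Y\<close>, \<open>j : X \<rightarrow> Z\<close>, \<open>i' : Z \<rightarrow> U\<close>, \<open>j' : Y \<rightarrow> U\<close>.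
\<close>

definition commutative_square :: "('o, 'm) precategory \<Rightarrow> 'm \<Rightarrow> 'm \<Rightarrow> 'm \<Rightarrow> 'm \<Rightarrow> bool" where
  "commutative_square C i j i' j' \<longleftrightarrow>
     {i, j, i', j'} \<subseteq> Arr C \<and> Dom C i = Dom C j \<and> Cod C i = Dom C j' \<and> Cod C j = Dom C i' \<and>
     Cod C i' = Cod C j' \<and> j' \<cdot>\<^bsub>C\<^esub> i = i' \<cdot>\<^bsub>C\<^esub> j"

definition cartesian :: "('o, 'm) precategory \<Rightarrow> 'm \<Rightarrow> 'm \<Rightarrow> 'm \<Rightarrow> 'm \<Rightarrow> bool" where
  "cartesian C i j i' j' \<longleftrightarrow> commutative_square C i j i' j' \<and>
     (\<forall>f g. commutative_square C f g i' j' \<longrightarrow>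
        (\<exists>!h. h \<in> Hom C (Dom C f) (Dom C i) \<and> i \<cdot>\<^bsub>C\<^esub> h = f \<and> j \<cdot>\<^bsub>C\<^esub> h = g))"

definition cocartesian :: "('o, 'm) precategory \<Rightarrow> 'm \<Rightarrow> 'm \<Rightarrow> 'm \<Rightarrow> 'm \<Rightarrow> bool" where
  "cocartesian C i j i' j' \<longleftrightarrow> commutative_square C i j i' j' \<and>
     (\<forall>f g. commutative_square C i j g f \<longrightarrow>
        (\<exists>!h. h \<in> Hom C (Cod C i') (Cod C f) \<and> h \<cdot>\<^bsub>C\<^esub> j' = f \<and> h \<cdot>\<^bsub>C\<^esub> i' = g))"

locale proto_exact = category C
  for C :: "('o, 'm) precategory" (structure) +
  fixes M P :: "'m set"
  assumes M_arr: "M \<subseteq> Arr C" and P_arr: "P \<subseteq> Arr C"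
    and PE1: "\<exists>Z. zero_object C Z \<and> (\<forall>X \<in> Obj C. Hom C Z X \<subseteq> M \<and> Hom C X Z \<subseteq> P)"
    and PE2_M: "f \<in> M \<Longrightarrow> g \<in> M \<Longrightarrow> Cod C f = Dom C g \<Longrightarrow> g \<cdot> f \<in> M"
    and PE2_P: "f \<in> P \<Longrightarrow> g \<in> P \<Longrightarrow> Cod C f = Dom C g \<Longrightarrow> g \<cdot> f \<in> P"
    and PE2_iso: "is_iso C f \<Longrightarrow> f \<in> M \<and> f \<in> P"
    and PE3: "i \<in> M \<Longrightarrow> i' \<in> M \<Longrightarrow> j \<in> P \<Longrightarrow> j' \<in> P \<Longrightarrow> commutative_square C i j i' j' \<Longrightarrow>
      cartesian C i j i' j' \<longleftrightarrow> cocartesian C i j i' j'"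
    and PE4: "i' \<in> M \<Longrightarrow> j' \<in> P \<Longrightarrow> Cod C i' = Cod C j' \<Longrightarrow>
      \<exists>i \<in> M. \<exists>j \<in> P. cartesian C i j i' j' \<and> cocartesian C i j i' j'"
    and PE5: "i \<in> M \<Longrightarrow> j \<in> P \<Longrightarrow> Dom C i = Dom C j \<Longrightarrow>
      \<exists>i' \<in> M. \<exists>j' \<in> P. cartesian C i j i' j' \<and> cocartesian C i j i' j'"


section \<open>The subquiver category\<close>

record ('v, 'l) labelled_quiver = "'v pair_pre_digraph" +
  lab :: "'v \<Rightarrow> 'l"

definition full_subquiver :: "'i pair_pre_digraph \<Rightarrow> 'i set \<Rightarrow> ('i, 'i) labelled_quiver" where
  "full_subquiver G J = \<lparr> pverts = J, parcs = parcs G \<inter> J \<times> J, lab = (\<lambda>a. a) \<rparr>"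

definition disjoint_union ::
  "('v, 'l) labelled_quiver list \<Rightarrow> (nat \<times> 'v, 'l) labelled_quiver" where
  "disjoint_union As =
     \<lparr> pverts = {(k, a). k < length As \<and> a \<in> pverts (As ! k)},
       parcs = {((k, a), (l, b)). k = l \<and> k < length As \<and> (a, b) \<in> parcs (As ! k)},
       lab = (\<lambda>(k, a). if k < length As \<and> a \<in> pverts (As ! k) then lab (As ! k) a else undefined) \<rparr>"

text \<open>
  A diagram of label-preserving full embeddings of \<open>P\<close> into \<open>A\<close> and \<open>B\<close> is encoded by the induced
  bijection between the two images of \<open>P\<close>, given as a relation between the vertices of \<open>A\<close> and \<open>B\<close>.
  Intersecting the two images in the middle object is then relational composition.
\<close>

record ('v, 'l) quiver_mor =
  source :: "('v, 'l) labelled_quiver"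
  target :: "('v, 'l) labelled_quiver"
  rel :: "('v \<times> 'v) set"

definition partial_isos ::
  "('v, 'l) labelled_quiver \<Rightarrow> ('v, 'l) labelled_quiver \<Rightarrow> ('v \<times> 'v) set set" where
  "partial_isos A B =
     {R. R \<subseteq> pverts A \<times> pverts B \<and> single_valued R \<and> single_valued (R\<inverse>) \<and>
         (\<forall>(a, b) \<in> R. lab A a = lab B b) \<and>
         (\<forall>(a, b) \<in> R. \<forall>(a', b') \<in> R. (a, a') \<in> parcs A \<longleftrightarrow> (b, b') \<in> parcs B)}"

definition subquiver_objects :: "'i pair_pre_digraph \<Rightarrow> (nat \<times> 'i, 'i) labelled_quiver set" where
  "subquiver_objects G =
     {disjoint_union (map (full_subquiver G) Js) | Js. set Js \<subseteq> Pow (pverts G)}"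

definition subquiver_category ::
  "'i pair_pre_digraph \<Rightarrow>
     ((nat \<times> 'i, 'i) labelled_quiver, (nat \<times> 'i, 'i) quiver_mor) precategory" where
  "subquiver_category G =
     \<lparr> Obj = subquiver_objects G,
       Arr = {f. source f \<in> subquiver_objects G \<and> target f \<in> subquiver_objects G \<and>
                 rel f \<in> partial_isos (source f) (target f)},
       Dom = source,
       Cod = target,
       Id = (\<lambda>A. \<lparr> source = A, target = A, rel = Id_on (pverts A) \<rparr>),
       Comp = (\<lambda>g f. \<lparr> source = source f, target = target g, rel = rel f O rel g \<rparr>) \<rparr>"

definition disjoint_union_mor ::
  "('v, 'l) quiver_mor list \<Rightarrow> (nat \<times> 'v, 'l) quiver_mor" where
  "disjoint_union_mor fs =
     \<lparr> source = disjoint_union (map source fs),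
       target = disjoint_union (map target fs),
       rel = {((k, a), (l, b)). k = l \<and> k < length fs \<and> (a, b) \<in> rel (fs ! k)} \<rparr>"

definition quiver_le :: "'i pair_pre_digraph \<Rightarrow> 'i \<Rightarrow> 'i \<Rightarrow> bool" where
  "quiver_le G a b \<longleftrightarrow> b \<rightarrow>\<^sup>*\<^bsub>with_proj G\<^esub> a"

definition basic_admissible_monos :: "'i pair_pre_digraph \<Rightarrow> ('i, 'i) quiver_mor set" where
  "basic_admissible_monos G =
     {\<lparr> source = full_subquiver G J, target = full_subquiver G H, rel = Id_on J \<rparr> | J H.
        J \<subseteq> H \<and> H \<subseteq> pverts G \<and> (\<forall>a \<in> J. {b \<in> H. quiver_le G b a} \<subseteq> J)}"

definition basic_admissible_epis :: "'i pair_pre_digraph \<Rightarrow> ('i, 'i) quiver_mor set" where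
  "basic_admissible_epis G =
     {\<lparr> source = full_subquiver G H, target = full_subquiver G K, rel = Id_on K \<rparr> | H K.
        K \<subseteq> H \<and> H \<subseteq> pverts G \<and> (\<forall>a \<in> K. {b \<in> H. quiver_le G a b} \<subseteq> K)}"

text \<open>
  Disjoint unions of labelled quivers are only determined up to isomorphism (reordering the
  summands, or splitting a disconnected summand, gives an isomorphic presentation of the same
  object), whereas \<^const>\<open>disjoint_union\<close> fixes one presentation.  Hence a morphism counts as a
  disjoint union of basic ones if it is so after identifying its source and its target, by
  isomorphisms of the category, with the chosen presentations.
\<close>

definition unions_up_to_iso ::
  "'i pair_pre_digraph \<Rightarrow> ('i, 'i) quiver_mor set \<Rightarrow> (nat \<times> 'i, 'i) quiver_mor set" where
  "unions_up_to_iso G F =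
     (let C = subquiver_category G in
      {\<psi> \<cdot>\<^bsub>C\<^esub> disjoint_union_mor fs \<cdot>\<^bsub>C\<^esub> \<phi> | \<phi> fs \<psi>.
         set fs \<subseteq> F \<and> is_iso C \<phi> \<and> is_iso C \<psi> \<and>
         Cod C \<phi> = source (disjoint_union_mor fs) \<and> Dom C \<psi> = target (disjoint_union_mor fs)})"

definition admissible_monos :: "'i pair_pre_digraph \<Rightarrow> (nat \<times> 'i, 'i) quiver_mor set" where
  "admissible_monos G = unions_up_to_iso G (basic_admissible_monos G)"

definition admissible_epis :: "'i pair_pre_digraph \<Rightarrow> (nat \<times> 'i, 'i) quiver_mor set" where
  "admissible_epis G = unions_up_to_iso G (basic_admissible_epis G)"

end

theory Submission
  imports Defs
begin

text \<open>
  A morphism of the subquiver category amounts to a partial bijection between the vertex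
  sets of its source and target that respects labels and both preserves and reflects arrows.  Every
  set of vertices of an object spans an object again, so subobjects are plain vertex subsets, and the
  converse of a morphism is a morphism.  This dagger involution exchanges source and target and
  cuts the work in half.

  The theorem rests on an intrinsic description of the two classes.  Call a morphism a closed embedding
  if it is defined on its whole source and its image is closed under following arrows of the target.
  When the underlying graph is a tree, the admissible monomorphisms are exactly the closed embeddings
  (lemma \<open>unions_of_basic_embeddings\<close>), and dually the admissible epimorphisms are the daggers of the
  embeddings closed under going backwards along arrows.  The hard inclusion splits the target
  into its connected components.  On each component \<open>H\<close> one gets an
  inclusion \<open>J \<subseteq> H\<close> with \<open>J\<close> closed under single arrows inside \<open>H\<close>, whereas admissibility asks for closure
  under paths of the whole quiver, which might leave \<open>H\<close>.  In a tree this cannot harm: a path that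
  starts in \<open>J\<close> and ends in \<open>H\<close> outside \<open>J\<close> must leave \<open>J\<close> for good along an arrow that also leaves \<open>H\<close>,
  and coming back to \<open>H\<close> closes up a cycle, although each edge of a tree is a bridge
  (lemmas \<open>edge_is_bridge\<close> and \<open>closed_under_paths\<close>).

  With this description the axioms become statements about vertex sets.  A commutative square of an
  embedding \<open>A \<subseteq> B\<close> and a quotient \<open>B \<rightarrow> D\<close>, with \<open>D\<close> regarded as a
  subset of \<open>B\<close>, forces \<open>C = A \<inter> D\<close>.  It is Cartesian if and only if \<open>A \<union> D = B\<close>
  (lemma \<open>cartesian_iff_cover\<close>).  The condition is symmetric, so it also describes
  coCartesian squares.  Completing a corner is then forced: \<open>A = C \<union> (B - D)\<close> or, dually,
  \<open>D = C \<union> (B - A)\<close>, and the two closure conditions on the given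
  morphisms yield those on the new ones (lemma \<open>closed_embedding_completion\<close>).
\<close>

section \<open>Partial isomorphisms\<close>

lemma partial_isosI:
  assumes "R \<subseteq> pverts A \<times> pverts B" "single_valued R" "single_valued (R\<inverse>)"
    and "\<And>a b. (a, b) \<in> R \<Longrightarrow> lab A a = lab B b"
    and "\<And>a b a' b'. (a, b) \<in> R \<Longrightarrow> (a', b') \<in> R \<Longrightarrow> (a, a') \<in> parcs A \<longleftrightarrow> (b, b') \<in> parcs B"
  shows "R \<in> partial_isos A B"
  using assms unfolding partial_isos_def by blast

lemma partial_isosD:
  assumes "R \<in> partial_isos A B"
  shows "R \<subseteq> pverts A \<times> pverts B" "single_valued R" "single_valued (R\<inverse>)"
    and "\<And>a b. (a, b) \<in> R \<Longrightarrow> lab A a = lab B b"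
    and "\<And>a b a' b'. (a, b) \<in> R \<Longrightarrow> (a', b') \<in> R \<Longrightarrow> (a, a') \<in> parcs A \<longleftrightarrow> (b, b') \<in> parcs B"
  using assms unfolding partial_isos_def by blast+

lemma partial_isos_comp:
  assumes R: "R \<in> partial_isos A B" and S: "S \<in> partial_isos B C"
  shows "R O S \<in> partial_isos A C"
proof (rule partial_isosI)
  show "R O S \<subseteq> pverts A \<times> pverts C"
    using partial_isosD(1)[OF R] partial_isosD(1)[OF S] by blast
  show "single_valued (R O S)" "single_valued ((R O S)\<inverse>)"
    using partial_isosD(2,3)[OF R] partial_isosD(2,3)[OF S]
    by (simp_all add: single_valued_relcomp converse_relcomp)
  show "lab A a = lab C c" if "(a, c) \<in> R O S" for a c
    using that partial_isosD(4)[OF R] partial_isosD(4)[OF S] by fastforce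
  show "(a, a') \<in> parcs A \<longleftrightarrow> (c, c') \<in> parcs C"
    if "(a, c) \<in> R O S" "(a', c') \<in> R O S" for a c a' c'
    using that partial_isosD(5)[OF R] partial_isosD(5)[OF S] by blast
qed

lemma partial_isos_converse:
  assumes "R \<in> partial_isos A B"
  shows "R\<inverse> \<in> partial_isos B A"
  using partial_isosD[OF assms] by (intro partial_isosI) (auto simp del: converse_iff simp: converse_iff)

lemma partial_isos_Id_on: "S \<subseteq> pverts A \<Longrightarrow> Id_on S \<in> partial_isos A A"
  by (rule partial_isosI) (auto simp: single_valued_def)


lemma relcomp_converse_Id_on: "single_valued (R\<inverse>) \<Longrightarrow> R O R\<inverse> = Id_on (Domain R)"
  unfolding single_valued_def by blast

lemma converse_relcomp_Id_on: "single_valued R \<Longrightarrow> R\<inverse> O R = Id_on (Range R)"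
  unfolding single_valued_def by blast

lemma relcomp_Id_on: "Range R \<subseteq> X \<Longrightarrow> R O Id_on X = R"
  by (auto simp: relcomp_unfold Id_on_iff)

lemma Id_on_relcomp: "Domain R \<subseteq> X \<Longrightarrow> Id_on X O R = R"
  by (auto simp: relcomp_unfold Id_on_iff)


section \<open>Objects as finite sets of labelled points in layers\<close>

text \<open>
  A disjoint union of full subquivers is determined by its vertex set alone: a point \<open>(k, a)\<close> is the vertex
  labelled \<open>a\<close> in the \<open>k\<close>-th summand.  The label outside the vertex set is the same default value as in
  \<^const>\<open>disjoint_union\<close>, so that objects are equal, and not only isomorphic, to such quivers.
\<close>

definition layered_quiver ::
  "'i pair_pre_digraph \<Rightarrow> (nat \<times> 'i) set \<Rightarrow> (nat \<times> 'i, 'i) labelled_quiver" where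
  "layered_quiver G V =
     \<lparr> pverts = V,
       parcs = {(x, y). x \<in> V \<and> y \<in> V \<and> fst x = fst y \<and> (snd x, snd y) \<in> parcs G},
       lab = (\<lambda>x. if x \<in> V then snd x else undefined) \<rparr>"

lemma pverts_layered [simp]: "pverts (layered_quiver G V) = V"
  by (simp add: layered_quiver_def)

lemma parcs_layered [simp]:
  "(x, y) \<in> parcs (layered_quiver G V) \<longleftrightarrow>
     x \<in> V \<and> y \<in> V \<and> fst x = fst y \<and> (snd x, snd y) \<in> parcs G"
  by (simp add: layered_quiver_def)

lemma lab_layered [simp]: "x \<in> V \<Longrightarrow> lab (layered_quiver G V) x = snd x"
  by (simp add: layered_quiver_def)

lemma disjoint_union_layered:
  "disjoint_union (map (full_subquiver G) Js)
     = layered_quiver G {(k, a). k < length Js \<and> a \<in> Js ! k}"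
  unfolding disjoint_union_def layered_quiver_def
  by (auto simp: full_subquiver_def fun_eq_iff)

lemma Id_on_partial_isos_layered:
  "S \<subseteq> U \<Longrightarrow> S \<subseteq> V \<Longrightarrow> Id_on S \<in> partial_isos (layered_quiver G U) (layered_quiver G V)"
  by (rule partial_isosI) (auto simp: single_valued_def subset_iff)

locale finite_quiver =
  fixes G :: "'i pair_pre_digraph"
  assumes finite_verts: "finite (pverts G)"
    and arcs_in_verts: "parcs G \<subseteq> pverts G \<times> pverts G"
begin

abbreviation S where "S \<equiv> subquiver_category G"

text \<open>
  A finite set of layered points lists its layers up to the largest occurring index; absent layers
  contribute empty summands, which leave no trace in the disjoint union.
\<close>

lemma objects_eq:
  "subquiver_objects G = layered_quiver G ` {V. finite V \<and> snd ` V \<subseteq> pverts G}"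
proof (rule equalityI; rule subsetI)
  fix A assume "A \<in> subquiver_objects G"
  then obtain Js where Js: "set Js \<subseteq> Pow (pverts G)"
    and A: "A = layered_quiver G {(k, a). k < length Js \<and> a \<in> Js ! k}"
    by (auto simp: subquiver_objects_def disjoint_union_layered)
  have sub: "{(k, a). k < length Js \<and> a \<in> Js ! k} \<subseteq> {..<length Js} \<times> pverts G"
    using Js nth_mem by fastforce
  then have "finite {(k, a). k < length Js \<and> a \<in> Js ! k}"
    by (rule finite_subset) (simp add: finite_verts)
  then show "A \<in> layered_quiver G ` {V. finite V \<and> snd ` V \<subseteq> pverts G}"
    unfolding A using sub by force
next
  fix A assume "A \<in> layered_quiver G ` {V. finite V \<and> snd ` V \<subseteq> pverts G}"
  then obtain V where V: "finite V" "snd ` V \<subseteq> pverts G" and A: "A = layered_quiver G V"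
    by auto
  obtain n where n: "fst ` V \<subseteq> {..<n}"
    using V(1) finite_nat_iff_bounded by blast
  define Js where "Js = map (\<lambda>k. {a. (k, a) \<in> V}) [0..<n]"
  have "{(k, a). k < length Js \<and> a \<in> Js ! k} = V"
    using n by (auto simp: Js_def)
  then have "A = disjoint_union (map (full_subquiver G) Js)"
    by (simp add: A disjoint_union_layered)
  moreover have "set Js \<subseteq> Pow (pverts G)"
    using V(2) by (auto simp: Js_def)
  ultimately show "A \<in> subquiver_objects G"
    by (auto simp: subquiver_objects_def)
qed

text \<open>Any set of vertices of an object spans an object, since summands may be disconnected or empty.\<close>

lemma object_restrict:
  assumes "layered_quiver G V \<in> subquiver_objects G" "U \<subseteq> V"
  shows "layered_quiver G U \<in> subquiver_objects G"
proof -
  have "finite V \<and> snd ` V \<subseteq> pverts G"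
    using assms(1) unfolding objects_eq by (metis (no_types, lifting) imageE mem_Collect_eq pverts_layered)
  then show ?thesis
    using assms(2) unfolding objects_eq by (auto intro: finite_subset)
qed

lemma object_cases:
  assumes "A \<in> subquiver_objects G"
  obtains V where "A = layered_quiver G V" "finite V" "snd ` V \<subseteq> pverts G"
  using assms unfolding objects_eq by auto


section \<open>The category and its dagger\<close>

lemma Obj_S [simp]: "Obj S = subquiver_objects G"
  and Dom_S [simp]: "Dom S = source"
  and Cod_S [simp]: "Cod S = target"
  and Id_S [simp]: "Id S A = \<lparr> source = A, target = A, rel = Id_on (pverts A) \<rparr>"
  and Comp_S [simp]: "g \<cdot>\<^bsub>S\<^esub> f = \<lparr> source = source f, target = target g, rel = rel f O rel g \<rparr>"
  and Arr_S: "f \<in> Arr S \<longleftrightarrow> source f \<in> subquiver_objects G \<and> target f \<in> subquiver_objects G \<and>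
    rel f \<in> partial_isos (source f) (target f)"
  by (simp_all add: subquiver_category_def)

lemma ArrD:
  assumes "f \<in> Arr S"
  shows "source f \<in> subquiver_objects G" "target f \<in> subquiver_objects G"
    "rel f \<in> partial_isos (source f) (target f)"
    "rel f \<subseteq> pverts (source f) \<times> pverts (target f)"
    "single_valued (rel f)" "single_valued ((rel f)\<inverse>)"
  using assms partial_isosD[of "rel f" "source f" "target f"] by (simp_all add: Arr_S)

lemma Id_on_Arr:
  "A \<in> subquiver_objects G \<Longrightarrow> U \<subseteq> pverts A \<Longrightarrow>
     \<lparr> source = A, target = A, rel = Id_on U \<rparr> \<in> Arr S"
  by (simp add: Arr_S partial_isos_Id_on)

lemma empty_Arr:
  "A \<in> subquiver_objects G \<Longrightarrow> B \<in> subquiver_objects G \<Longrightarrow>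
     \<lparr> source = A, target = B, rel = {} \<rparr> \<in> Arr S"
  by (simp add: Arr_S partial_isos_def)

lemma Comp_Arr:
  assumes "f \<in> Arr S" "g \<in> Arr S" "target f = source g"
  shows "g \<cdot>\<^bsub>S\<^esub> f \<in> Arr S"
  using assms by (auto simp: Arr_S intro: partial_isos_comp)

lemma category_S: "category S"
proof
  fix f g h X Y Z U
  show "f \<in> Arr S \<Longrightarrow> Dom S f \<in> Obj S \<and> Cod S f \<in> Obj S"
    by (simp add: Arr_S)
  show "X \<in> Obj S \<Longrightarrow> Id S X \<in> Hom S X X"
    by (simp add: Hom_def Arr_S partial_isos_Id_on)
  show "f \<in> Hom S X Y \<Longrightarrow> g \<in> Hom S Y Z \<Longrightarrow> g \<cdot>\<^bsub>S\<^esub> f \<in> Hom S X Z"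
    by (auto simp: Hom_def Arr_S intro: partial_isos_comp)
  show "Id S Y \<cdot>\<^bsub>S\<^esub> f = f" "f \<cdot>\<^bsub>S\<^esub> Id S X = f" if "f \<in> Hom S X Y"
  proof -
    have "rel f \<subseteq> pverts X \<times> pverts Y" "source f = X" "target f = Y"
      using that ArrD(4)[of f] by (auto simp: Hom_def)
    moreover from this have "rel f O Id_on (pverts Y) = rel f" "Id_on (pverts X) O rel f = rel f"
      by blast+
    ultimately show "Id S Y \<cdot>\<^bsub>S\<^esub> f = f" "f \<cdot>\<^bsub>S\<^esub> Id S X = f"
      by auto
  qed
  show "h \<cdot>\<^bsub>S\<^esub> g \<cdot>\<^bsub>S\<^esub> f = h \<cdot>\<^bsub>S\<^esub> (g \<cdot>\<^bsub>S\<^esub> f)"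
    by (simp add: O_assoc)
qed

end

text \<open>
  Reading a diagram \<open>A \<hookleftarrow> P \<hookrightarrow> B\<close> from right to left makes the category its own opposite.
\<close>

definition dagger :: "('v, 'l) quiver_mor \<Rightarrow> ('v, 'l) quiver_mor" where
  "dagger f = \<lparr> source = target f, target = source f, rel = (rel f)\<inverse> \<rparr>"

lemma dagger_simps [simp]:
  "source (dagger f) = target f" "target (dagger f) = source f" "rel (dagger f) = (rel f)\<inverse>"
  "dagger (dagger f) = f"
  by (simp_all add: dagger_def)

lemma dagger_inject [simp]: "dagger f = dagger g \<longleftrightarrow> f = g"
  by (metis dagger_simps(4))

lemma ex1_dagger: "(\<exists>!h. A (dagger h)) \<longleftrightarrow> (\<exists>!h. A h)"
  by (metis dagger_simps(4))

context finite_quiver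
begin

lemma dagger_Arr [simp]: "dagger f \<in> Arr S \<longleftrightarrow> f \<in> Arr S"
proof -
  have "f \<in> Arr S \<Longrightarrow> dagger f \<in> Arr S" for f :: "(nat \<times> 'i, 'i) quiver_mor"
    by (auto simp: Arr_S intro: partial_isos_converse)
  from this[of f] this[of "dagger f"] show ?thesis by auto
qed

lemma dagger_comp: "dagger (g \<cdot>\<^bsub>S\<^esub> f) = dagger f \<cdot>\<^bsub>S\<^esub> dagger g"
  by (simp add: dagger_def converse_relcomp)

text \<open>The inverse is the dagger: a partial bijection composed with its converse is a partial identity.\<close>

lemma is_iso_iff:
  "is_iso S f \<longleftrightarrow>
     f \<in> Arr S \<and> Domain (rel f) = pverts (source f) \<and> Range (rel f) = pverts (target f)"
proof (intro iffI conjI)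
  assume iso: "is_iso S f"
  then show f: "f \<in> Arr S" by (simp add: is_iso_def)
  obtain g :: "(nat \<times> 'i, 'i) quiver_mor" where "rel f O rel g = Id_on (pverts (source f))"
    "rel g O rel f = Id_on (pverts (target f))"
    using iso by (auto simp: is_iso_def)
  then have "pverts (source f) \<subseteq> Domain (rel f)" "pverts (target f) \<subseteq> Range (rel f)"
    by blast+
  then show "Domain (rel f) = pverts (source f)" "Range (rel f) = pverts (target f)"
    using ArrD(4)[OF f] by auto
next
  assume f: "f \<in> Arr S \<and> Domain (rel f) = pverts (source f) \<and> Range (rel f) = pverts (target f)"
  have "rel f O (rel f)\<inverse> = Id_on (pverts (source f))"
    "(rel f)\<inverse> O rel f = Id_on (pverts (target f))"
    using f ArrD(5,6)[of f] relcomp_converse_Id_on[of "rel f"] converse_relcomp_Id_on[of "rel f"]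
    by simp_all
  then have "dagger f \<in> Hom S (target f) (source f) \<and> dagger f \<cdot>\<^bsub>S\<^esub> f = Id S (source f) \<and>
      f \<cdot>\<^bsub>S\<^esub> dagger f = Id S (target f)"
    using f by (simp add: Hom_def)
  then show "is_iso S f"
    unfolding is_iso_def Dom_S Cod_S using f by blast
qed

lemma is_iso_dagger [simp]: "is_iso S (dagger f) \<longleftrightarrow> is_iso S f"
  by (auto simp: is_iso_iff)

lemma is_iso_Arr: "is_iso S f \<Longrightarrow> f \<in> Arr S"
  by (simp add: is_iso_def)

lemma commutative_square_iff:
  "commutative_square S i j i' j' \<longleftrightarrow>
     i \<in> Arr S \<and> j \<in> Arr S \<and> i' \<in> Arr S \<and> j' \<in> Arr S \<and>
     source i = source j \<and> target i = source j' \<and> target j = source i' \<and>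
     target i' = target j' \<and> rel i O rel j' = rel j O rel i'"
  by (auto simp: commutative_square_def)

lemma commutative_square_dagger:
  "commutative_square S (dagger j') (dagger i') (dagger j) (dagger i) \<longleftrightarrow>
     commutative_square S i j i' j'"
  unfolding commutative_square_iff by (auto simp flip: converse_relcomp)

text \<open>
  The dagger turns a square around its other diagonal, which turns pushouts into pullbacks.
\<close>

lemma cocartesian_iff_dagger:
  "cocartesian S i j i' j' \<longleftrightarrow> cartesian S (dagger j') (dagger i') (dagger j) (dagger i)"
  (is "?L \<longleftrightarrow> ?R")
proof -
  have ex1: "(\<exists>!h. h \<in> Hom S (target i') (target f) \<and> h \<cdot>\<^bsub>S\<^esub> j' = f \<and> h \<cdot>\<^bsub>S\<^esub> i' = g) \<longleftrightarrow>
    (\<exists>!h. h \<in> Hom S (source (dagger f)) (source (dagger j')) \<and>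
       dagger j' \<cdot>\<^bsub>S\<^esub> h = dagger f \<and> dagger i' \<cdot>\<^bsub>S\<^esub> h = dagger g)" (is "Ex1 ?A \<longleftrightarrow> Ex1 ?B")
    if "target i' = target j'" for f g
  proof -
    have eq: "?B h = ?A (dagger h)" for h
    proof -
      have hom: "h \<in> Hom S (source (dagger f)) (source (dagger j')) \<longleftrightarrow>
          dagger h \<in> Hom S (target i') (target f)"
        using that by (auto simp: Hom_def)
      have "dagger j' \<cdot>\<^bsub>S\<^esub> h = dagger (dagger h \<cdot>\<^bsub>S\<^esub> j')" "dagger i' \<cdot>\<^bsub>S\<^esub> h = dagger (dagger h \<cdot>\<^bsub>S\<^esub> i')"
        by (simp_all only: dagger_comp dagger_simps)
      then show ?thesis
        unfolding hom by (simp only: dagger_inject)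
    qed
    show ?thesis
      unfolding eq by (rule ex1_dagger[symmetric])
  qed
  show ?thesis
  proof
    assume L: ?L
    then have sq: "commutative_square S i j i' j'" by (simp add: cocartesian_def)
    then have t: "target i' = target j'" by (simp add: commutative_square_iff)
    show ?R unfolding cartesian_def commutative_square_dagger Dom_S
    proof (intro conjI sq allI impI)
      fix f g assume "commutative_square S f g (dagger j) (dagger i)"
      then have "commutative_square S i j (dagger g) (dagger f)"
        using commutative_square_dagger[of "dagger f" "dagger g" j i] by simp
      with L have "\<exists>!h. h \<in> Hom S (target i') (target (dagger f)) \<and>
          h \<cdot>\<^bsub>S\<^esub> j' = dagger f \<and> h \<cdot>\<^bsub>S\<^esub> i' = dagger g"
        unfolding cocartesian_def Cod_S by blast
      then show "\<exists>!h. h \<in> Hom S (source f) (source (dagger j')) \<and>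
          dagger j' \<cdot>\<^bsub>S\<^esub> h = f \<and> dagger i' \<cdot>\<^bsub>S\<^esub> h = g"
        unfolding ex1[OF t] dagger_simps(4) .
    qed
  next
    assume R: ?R
    then have sq: "commutative_square S i j i' j'"
      by (simp add: cartesian_def commutative_square_dagger)
    then have t: "target i' = target j'" by (simp add: commutative_square_iff)
    show ?L unfolding cocartesian_def Cod_S
    proof (intro conjI sq allI impI)
      fix f g assume "commutative_square S i j g f"
      then have "commutative_square S (dagger f) (dagger g) (dagger j) (dagger i)"
        by (simp add: commutative_square_dagger)
      with R show "\<exists>!h. h \<in> Hom S (target i') (target f) \<and> h \<cdot>\<^bsub>S\<^esub> j' = f \<and> h \<cdot>\<^bsub>S\<^esub> i' = g"
        unfolding ex1[OF t] cartesian_def Dom_S by blast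
    qed
  qed
qed


section \<open>Cartesian squares\<close>

text \<open>
  View all corners inside \<open>B\<close>, the target of \<open>i\<close>: \<open>A\<close> is the range of \<open>i\<close> and \<open>D\<close> the domain of \<open>j'\<close>.  A
  competing \<open>f : T \<rightarrow> B\<close> factors through \<open>A\<close> if and only if its range lies in \<open>A\<close>.  The part of the range
  in \<open>D\<close> does so by commutativity, while the part outside \<open>D\<close> is unconstrained.  Hence the square is
  Cartesian precisely if nothing of \<open>B\<close> lies outside both \<open>A\<close> and \<open>D\<close>.
\<close>

lemma cartesian_iff_cover:
  assumes sq: "commutative_square S i j i' j'"
    and total: "Domain (rel i) = pverts (source i)" "Domain (rel i') = pverts (source i')"
    and surj: "Range (rel j) = pverts (target j)"
  shows "cartesian S i j i' j' \<longleftrightarrow> Range (rel i) \<union> Domain (rel j') = pverts (target i)"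
proof
  note sqD = sq[unfolded commutative_square_iff]
  let ?B = "target i"
  assume cart: "cartesian S i j i' j'"
  \<comment> \<open>The worst competitor is the partial identity on all vertices that \<open>j'\<close> kills.\<close>
  let ?K = "pverts ?B - Domain (rel j')"
  let ?f = "\<lparr> source = ?B, target = ?B, rel = Id_on ?K \<rparr>"
  let ?g = "\<lparr> source = ?B, target = target j, rel = {} \<rparr>"
  have "commutative_square S ?f ?g i' j'"
  proof -
    have "target i \<in> subquiver_objects G" "target j \<in> subquiver_objects G"
      using sqD ArrD(2) by blast+
    then have "?f \<in> Arr S" "?g \<in> Arr S"
      by (simp_all add: Id_on_Arr empty_Arr)
    moreover have "Id_on ?K O rel j' = {}" by blast
    ultimately show ?thesis using sqD by (simp add: commutative_square_iff)
  qed
  then obtain h where "i \<cdot>\<^bsub>S\<^esub> h = ?f"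
    using cart unfolding cartesian_def by blast
  then have "rel h O rel i = Id_on ?K" by simp
  then have "?K \<subseteq> Range (rel i)" by blast
  then show "Range (rel i) \<union> Domain (rel j') = pverts ?B"
    using ArrD(4)[of i] ArrD(4)[of j'] sqD by auto
next
  note sqD = sq[unfolded commutative_square_iff]
  assume cover: "Range (rel i) \<union> Domain (rel j') = pverts (target i)"
  have i: "i \<in> Arr S" and i': "i' \<in> Arr S" using sqD by auto
  have ii: "rel i O (rel i)\<inverse> = Id_on (pverts (source i))"
    using ArrD(6)[OF i] total(1) relcomp_converse_Id_on[of "rel i"] by simp
  have i'i': "rel i' O (rel i')\<inverse> = Id_on (pverts (source i'))"
    using ArrD(6)[OF i'] total(2) relcomp_converse_Id_on[of "rel i'"] by simp
  show "cartesian S i j i' j'"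
    unfolding cartesian_def
  proof (intro conjI sq allI impI)
    fix f g assume fg: "commutative_square S f g i' j'"
    note fgD = fg[unfolded commutative_square_iff]
    have f: "f \<in> Arr S" and g: "g \<in> Arr S" using fgD by auto
    let ?h = "dagger i \<cdot>\<^bsub>S\<^esub> f"
    \<comment> \<open>The candidate \<open>h\<close> is \<open>f\<close> with its values pulled back along \<open>i\<close>; it loses nothing.\<close>
    have ran: "Range (rel f) \<subseteq> Range (rel i)"
    proof
      fix y assume "y \<in> Range (rel f)"
      then obtain x where xy: "(x, y) \<in> rel f" by auto
      show "y \<in> Range (rel i)"
      proof (cases "y \<in> Domain (rel j')")
        case True
        then obtain z where z: "(y, z) \<in> rel j'" by auto
        then have "(x, z) \<in> rel g O rel i'" using xy fgD by auto
        then obtain c where c: "(c, z) \<in> rel i'" by auto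
        then have "c \<in> Range (rel j)" using surj ArrD(4)[OF i'] sqD by auto
        then obtain a where a: "(a, c) \<in> rel j" by auto
        then have "(a, z) \<in> rel i O rel j'" using c sqD by auto
        then obtain y' where y': "(a, y') \<in> rel i" "(y', z) \<in> rel j'" by auto
        have "y' = y" using y'(2) z ArrD(6)[of j'] sqD by (meson converseI single_valuedD)
        then show ?thesis using y' by auto
      next
        case False
        then show ?thesis using cover xy ArrD(4)[OF f] fgD sqD by auto
      qed
    qed
    have ffi: "(rel f O (rel i)\<inverse>) O rel i = rel f"
      using ran relcomp_Id_on unfolding O_assoc converse_relcomp_Id_on[OF ArrD(5)[OF i]] by blast
    then have hf: "i \<cdot>\<^bsub>S\<^esub> ?h = f" using ffi fgD sqD by simp
    \<comment> \<open>The second equation can be tested after the monomorphism \<open>i'\<close>.\<close>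
    have "rel (j \<cdot>\<^bsub>S\<^esub> ?h) O rel i' = (rel f O (rel i)\<inverse>) O (rel j O rel i')"
      by (simp add: O_assoc)
    also have "\<dots> = ((rel f O (rel i)\<inverse>) O rel i) O rel j'"
      using sqD by (simp only: O_assoc)
    also have "\<dots> = rel g O rel i'"
      using fgD unfolding ffi by simp
    finally have "rel (j \<cdot>\<^bsub>S\<^esub> ?h) O (rel i' O (rel i')\<inverse>) = rel g O (rel i' O (rel i')\<inverse>)"
      by (simp add: O_assoc[symmetric])
    moreover have "rel (j \<cdot>\<^bsub>S\<^esub> ?h) \<subseteq> UNIV \<times> pverts (source i')" "rel g \<subseteq> UNIV \<times> pverts (source i')"
      using ArrD(4)[of j] ArrD(4)[OF g] sqD fgD by auto
    ultimately have "rel (j \<cdot>\<^bsub>S\<^esub> ?h) = rel g"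
      unfolding i'i' by blast
    then have hg: "j \<cdot>\<^bsub>S\<^esub> ?h = g" using fgD sqD by simp
    have hom: "?h \<in> Hom S (Dom S f) (Dom S i)"
      using Comp_Arr[of f "dagger i"] f i fgD sqD by (simp add: Hom_def)
    have uniq: "h = ?h" if h: "h \<in> Hom S (Dom S f) (Dom S i)" "i \<cdot>\<^bsub>S\<^esub> h = f" for h
    proof -
      have "rel h \<subseteq> UNIV \<times> pverts (source i)"
        using h(1) ArrD(4)[of h] by (auto simp: Hom_def)
      then have "rel h = rel h O (rel i O (rel i)\<inverse>)"
        unfolding ii by (intro relcomp_Id_on[symmetric]) auto
      also have "\<dots> = (rel h O rel i) O (rel i)\<inverse>" by (simp only: O_assoc)
      also have "rel h O rel i = rel f" using h(2) by auto
      finally show ?thesis using h(1) by (auto simp: Hom_def intro: quiver_mor.equality)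
    qed
    show "\<exists>!h. h \<in> Hom S (Dom S f) (Dom S i) \<and> i \<cdot>\<^bsub>S\<^esub> h = f \<and> j \<cdot>\<^bsub>S\<^esub> h = g"
      using hom hf hg uniq by blast
  qed
qed

lemma cocartesian_iff_cover:
  assumes sq: "commutative_square S i j i' j'"
    and total: "Domain (rel i') = pverts (source i')"
    and surj: "Range (rel j) = pverts (target j)" "Range (rel j') = pverts (target j')"
  shows "cocartesian S i j i' j' \<longleftrightarrow> Range (rel i) \<union> Domain (rel j') = pverts (target i)"
proof -
  have "target i = source j'"
    using sq by (simp add: commutative_square_iff)
  then show ?thesis
    using cartesian_iff_cover[of "dagger j'" "dagger i'" "dagger j" "dagger i"] assms
    unfolding cocartesian_iff_dagger commutative_square_dagger by (simp add: Un_commute)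
qed

end


section \<open>Closed embeddings\<close>

text \<open>
  The flag selects the direction in which arrows are read, so that statements about monomorphisms
  and, after a dagger, about epimorphisms are instances of one another.
\<close>

definition directed :: "bool \<Rightarrow> 'a rel \<Rightarrow> 'a rel" where
  "directed d E = (if d then E else E\<inverse>)"

context finite_quiver
begin

text \<open>
  For \<open>d = True\<close> the image is closed under successors, as for admissible monomorphisms.  For \<open>d = False\<close> it is
  the dagger that matters: a surjection whose domain is closed under predecessors, as for admissible
  epimorphisms.
\<close>

definition closed_embedding :: "bool \<Rightarrow> (nat \<times> 'i, 'i) quiver_mor \<Rightarrow> bool" where
  "closed_embedding d f \<longleftrightarrow> f \<in> Arr S \<and> Domain (rel f) = pverts (source f) \<and>
     directed d (parcs (target f)) `` Range (rel f) \<subseteq> Range (rel f)"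

lemma directed_parcs_layered:
  "(x, y) \<in> directed d (parcs (layered_quiver G V)) \<longleftrightarrow>
     x \<in> V \<and> y \<in> V \<and> fst x = fst y \<and> (snd x, snd y) \<in> directed d (parcs G)"
  by (auto simp: directed_def)

lemma directed_parcs_subset:
  assumes "A \<in> subquiver_objects G"
  shows "directed d (parcs A) \<subseteq> pverts A \<times> pverts A"
  using assms directed_parcs_layered by (fastforce elim!: object_cases)

lemma directed_parcs_rel:
  assumes "f \<in> Arr S" "(a, b) \<in> rel f" "(a', b') \<in> rel f"
  shows "(a, a') \<in> directed d (parcs (source f)) \<longleftrightarrow> (b, b') \<in> directed d (parcs (target f))"
  using partial_isosD(5)[OF ArrD(3)[OF assms(1)]] assms(2,3) by (simp add: directed_def)

lemma closed_embeddingD: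
  assumes "closed_embedding d f"
  shows "f \<in> Arr S" "Domain (rel f) = pverts (source f)"
    and "\<And>x y. x \<in> Range (rel f) \<Longrightarrow> (x, y) \<in> directed d (parcs (target f)) \<Longrightarrow> y \<in> Range (rel f)"
  using assms unfolding closed_embedding_def by blast+

lemma closed_embedding_iso:
  assumes "is_iso S f"
  shows "closed_embedding d f"
proof -
  have "f \<in> Arr S" "Domain (rel f) = pverts (source f)" "Range (rel f) = pverts (target f)"
    using assms by (auto simp: is_iso_iff)
  moreover from this have "directed d (parcs (target f)) \<subseteq> pverts (target f) \<times> pverts (target f)"
    using directed_parcs_subset ArrD(2) by blast
  ultimately show ?thesis unfolding closed_embedding_def by blast
qed

text \<open>
  An arrow leaving the image of the composite ends in the image of \<open>g\<close>.  As \<open>g\<close> reflects arrows, it lifts to an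
  arrow leaving the image of \<open>f\<close>.
\<close>

lemma closed_embedding_comp:
  assumes f: "closed_embedding d f" and g: "closed_embedding d g" and fg: "target f = source g"
  shows "closed_embedding d (g \<cdot>\<^bsub>S\<^esub> f)"
  unfolding closed_embedding_def
proof (intro conjI)
  note fD = closed_embeddingD[OF f] and gD = closed_embeddingD[OF g]
  show "g \<cdot>\<^bsub>S\<^esub> f \<in> Arr S" using fD(1) gD(1) fg by (rule Comp_Arr)
  have "Range (rel f) \<subseteq> Domain (rel g)"
    using ArrD(4)[OF fD(1)] gD(2) fg by auto
  then have "Domain (rel f O rel g) = Domain (rel f)"
    by fast
  then show "Domain (rel (g \<cdot>\<^bsub>S\<^esub> f)) = pverts (source (g \<cdot>\<^bsub>S\<^esub> f))"
    using fD(2) by simp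
  show "directed d (parcs (target (g \<cdot>\<^bsub>S\<^esub> f))) `` Range (rel (g \<cdot>\<^bsub>S\<^esub> f)) \<subseteq> Range (rel (g \<cdot>\<^bsub>S\<^esub> f))"
  proof
    fix c' assume "c' \<in> directed d (parcs (target (g \<cdot>\<^bsub>S\<^esub> f))) `` Range (rel (g \<cdot>\<^bsub>S\<^esub> f))"
    then obtain a b c where abc: "(a, b) \<in> rel f" "(b, c) \<in> rel g"
      and c': "(c, c') \<in> directed d (parcs (target g))"
      by auto
    obtain b' where b': "(b', c') \<in> rel g"
      using gD(3)[OF _ c'] abc(2) by blast
    have "(b, b') \<in> directed d (parcs (target f))"
      using directed_parcs_rel[OF gD(1) abc(2) b', of d] c' fg by simp
    then have "b' \<in> Range (rel f)"
      using fD(3) abc(1) by blast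
    then show "c' \<in> Range (rel (g \<cdot>\<^bsub>S\<^esub> f))"
      using b' by auto
  qed
qed

text \<open>
  The missing corner consists of the vertices of \<open>B\<close> that \<open>j'\<close> either kills or sends into \<open>C\<close>; any Cartesian
  completion has to contain both.  It is closed because the killed vertices are
  closed in direction \<open>d\<close>, being the complement of a set closed in the opposite direction.  Both directions
  \<open>d\<close> occur: one gives pullbacks, the other one, through the dagger, pushouts.
\<close>

lemma closed_embedding_completion:
  assumes i': "closed_embedding d i'" and j': "closed_embedding (\<not> d) (dagger j')"
    and cod: "target i' = target j'"
  obtains i j where "closed_embedding d i" "closed_embedding (\<not> d) (dagger j)"
    "commutative_square S i j i' j'" "Range (rel i) \<union> Domain (rel j') = pverts (target i)"
proof -
  note iD = closed_embeddingD[OF i']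
  have jA: "j' \<in> Arr S" and jR: "Range (rel j') = pverts (target j')"
    using closed_embeddingD(1,2)[OF j'] by simp_all
  have jC: "y \<in> Domain (rel j')"
    if "x \<in> Domain (rel j')" "(x, y) \<in> directed (\<not> d) (parcs (source j'))" for x y
    using closed_embeddingD(3)[OF j'] that by simp
  have flip: "(y, x) \<in> directed (\<not> d) E" if "(x, y) \<in> directed d E" for x y and E :: "(nat \<times> 'i) rel"
    using that by (auto simp: directed_def split: if_splits)
  let ?B = "source j'"
  define U where "U = {x \<in> pverts ?B. \<forall>y. (x, y) \<in> rel j' \<longrightarrow> y \<in> Range (rel i')}"
  define i where "i = \<lparr> source = layered_quiver G U, target = ?B, rel = Id_on U \<rparr>"
  define j where "j = dagger i' \<cdot>\<^bsub>S\<^esub> (j' \<cdot>\<^bsub>S\<^esub> i)"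
  obtain V where B: "?B = layered_quiver G V"
    using ArrD(1)[OF jA] by (auto elim: object_cases)
  have UV: "U \<subseteq> V" using B by (auto simp: U_def)
  have jV: "Domain (rel j') \<subseteq> V" using ArrD(4)[OF jA] B by auto
  have U_iff: "x \<in> U \<longleftrightarrow> y \<in> Range (rel i')" if "(x, y) \<in> rel j'" for x y
  proof -
    have "x \<in> pverts ?B" using that jV B by auto
    moreover have "y' = y" if "(x, y') \<in> rel j'" for y'
      using that \<open>(x, y) \<in> rel j'\<close> ArrD(5)[OF jA] by (rule single_valuedD[rotated])
    ultimately show ?thesis using that unfolding U_def by blast
  qed
  have A: "layered_quiver G U \<in> subquiver_objects G"
    using ArrD(1)[OF jA] UV unfolding B by (rule object_restrict)
  have iA: "i \<in> Arr S"
    using A ArrD(1)[OF jA] UV B by (simp add: i_def Arr_S Id_on_partial_isos_layered)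
  have jA': "j \<in> Arr S"
    unfolding j_def using iA jA iD(1) cod by (intro Comp_Arr) (simp_all add: i_def)
  have rel_j: "rel j = Id_on U O rel j' O (rel i')\<inverse>"
    by (simp add: j_def i_def O_assoc)
  have st_j: "source j = layered_quiver G U" "target j = source i'"
    by (simp_all add: j_def i_def)
  have dom_j: "x \<in> Domain (rel j) \<longleftrightarrow> x \<in> U \<and> x \<in> Domain (rel j')" for x
    using U_iff unfolding rel_j by blast
  have "closed_embedding d i"
    unfolding closed_embedding_def
  proof (intro conjI iA)
    show "Domain (rel i) = pverts (source i)" by (auto simp: i_def)
    show "directed d (parcs (target i)) `` Range (rel i) \<subseteq> Range (rel i)"
    proof
      fix x' assume "x' \<in> directed d (parcs (target i)) `` Range (rel i)"
      then obtain x where x: "x \<in> U" and xx': "(x, x') \<in> directed d (parcs ?B)"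
        by (auto simp: i_def)
      have "y' \<in> Range (rel i')" if y': "(x', y') \<in> rel j'" for y'
      proof -
        have "x \<in> Domain (rel j')"
          using jC[of x' x] flip[OF xx'] y' by blast
        then obtain y where y: "(x, y) \<in> rel j'" by auto
        have "(y, y') \<in> directed d (parcs (target i'))"
          using directed_parcs_rel[OF jA y y', of d] xx' cod by simp
        then show ?thesis
          using iD(3) U_iff[OF y] x by blast
      qed
      moreover have "x' \<in> pverts ?B"
        using xx' unfolding B directed_parcs_layered by simp
      ultimately show "x' \<in> Range (rel i)"
        by (auto simp: i_def U_def)
    qed
  qed
  moreover have "closed_embedding (\<not> d) (dagger j)"
    unfolding closed_embedding_def
  proof (intro conjI)
    show "dagger j \<in> Arr S" using jA' by simp
    have "pverts (source i') \<subseteq> Range (rel j)"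
    proof
      fix c assume "c \<in> pverts (source i')"
      then obtain y where y: "(c, y) \<in> rel i'" using iD(2) by (metis DomainE)
      then have "y \<in> Range (rel j')" using ArrD(4)[OF iD(1)] jR cod by auto
      then obtain x where x: "(x, y) \<in> rel j'" by auto
      then have "x \<in> U" using U_iff y by blast
      then show "c \<in> Range (rel j)" unfolding rel_j using x y by blast
    qed
    then show "Domain (rel (dagger j)) = pverts (source (dagger j))"
      using ArrD(4)[OF jA'] by (auto simp: j_def)
    show "directed (\<not> d) (parcs (target (dagger j))) `` Range (rel (dagger j)) \<subseteq> Range (rel (dagger j))"
    proof
      fix x' assume "x' \<in> directed (\<not> d) (parcs (target (dagger j))) `` Range (rel (dagger j))"
      then obtain x where x: "x \<in> Domain (rel j)"
        and xx': "(x, x') \<in> directed (\<not> d) (parcs (layered_quiver G U))"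
        using st_j by auto
      then have B': "(x, x') \<in> directed (\<not> d) (parcs ?B)" and "x' \<in> U"
        using UV unfolding B directed_parcs_layered by auto
      moreover have "x' \<in> Domain (rel j')"
        using jC[OF _ B'] x dom_j by blast
      ultimately show "x' \<in> Range (rel (dagger j))"
        using dom_j by simp
    qed
  qed
  moreover have "commutative_square S i j i' j'"
  proof -
    have "rel j O rel i' = Id_on U O rel j' O Id_on (Range (rel i'))"
      unfolding rel_j O_assoc using converse_relcomp_Id_on[OF ArrD(5)[OF iD(1)]] by simp
    also have "\<dots> = Id_on U O rel j'"
      using U_iff by (auto simp: relcomp_unfold Id_on_iff)
    finally have "rel i O rel j' = rel j O rel i'"
      by (simp add: i_def)
    then show ?thesis
      using iA jA' iD(1) jA cod by (simp add: commutative_square_iff i_def j_def)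
  qed
  moreover have "Range (rel i) \<union> Domain (rel j') = pverts (target i)"
    using jV by (auto simp: i_def U_def B)
  ultimately show thesis by (rule that)
qed

lemma Hom_empty_layered:
  assumes "X \<in> subquiver_objects G"
  shows "Hom S (layered_quiver G {}) X = {\<lparr> source = layered_quiver G {}, target = X, rel = {} \<rparr>}"
    "Hom S X (layered_quiver G {}) = {\<lparr> source = X, target = layered_quiver G {}, rel = {} \<rparr>}"
proof -
  have Z: "layered_quiver G {} \<in> subquiver_objects G" unfolding objects_eq by blast
  have "rel f = {}" if "f \<in> Arr S" "source f = layered_quiver G {} \<or> target f = layered_quiver G {}" for f
    using ArrD(4)[OF that(1)] that(2) by auto
  then have *: "f = \<lparr> source = source f, target = target f, rel = {} \<rparr>"
    if "f \<in> Arr S" "source f = layered_quiver G {} \<or> target f = layered_quiver G {}" for f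
    using that by simp
  show "Hom S (layered_quiver G {}) X = {\<lparr> source = layered_quiver G {}, target = X, rel = {} \<rparr>}"
    using * empty_Arr[OF Z assms] by (force simp: Hom_def)
  show "Hom S X (layered_quiver G {}) = {\<lparr> source = X, target = layered_quiver G {}, rel = {} \<rparr>}"
    using * empty_Arr[OF assms Z] by (force simp: Hom_def)
qed

text \<open>
  The covering condition \<open>A \<union> D = B\<close> is common to both universal properties, which gives the third axiom at
  once and reduces the other two to finding the missing corner.
\<close>

proposition proto_exact_closed_embeddings:
  "proto_exact S {f. closed_embedding True f} {f. closed_embedding False (dagger f)}"
proof -
  interpret category S by (rule category_S)
  have total: "Domain (rel f) = pverts (source f)" if "closed_embedding True f" for f
    using that by (rule closed_embeddingD(2))
  have surj: "Range (rel f) = pverts (target f)" if "closed_embedding False (dagger f)" for f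
    using closed_embeddingD(2)[OF that] by simp
  have bicart: "cartesian S i j i' j' \<and> cocartesian S i j i' j'"
    if "closed_embedding True i" "closed_embedding True i'"
      "closed_embedding False (dagger j)" "closed_embedding False (dagger j')"
      "commutative_square S i j i' j'" "Range (rel i) \<union> Domain (rel j') = pverts (target i)"
    for i j i' j'
    using cartesian_iff_cover[OF that(5) total[OF that(1)] total[OF that(2)] surj[OF that(3)]]
      cocartesian_iff_cover[OF that(5) total[OF that(2)] surj[OF that(3)] surj[OF that(4)]] that(6)
    by simp
  show ?thesis
  proof
    show "{f. closed_embedding True f} \<subseteq> Arr S" "{f. closed_embedding False (dagger f)} \<subseteq> Arr S"
      by (auto simp: closed_embedding_def)
  next
    let ?Z = "layered_quiver G {}"
    have Z: "?Z \<in> subquiver_objects G" unfolding objects_eq by blast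
    show "\<exists>Z. zero_object S Z \<and> (\<forall>X\<in>Obj S. Hom S Z X \<subseteq> {f. closed_embedding True f} \<and>
        Hom S X Z \<subseteq> {f. closed_embedding False (dagger f)})"
      by (rule exI[of _ ?Z])
        (simp add: zero_object_def Z Hom_empty_layered closed_embedding_def empty_Arr dagger_def)
  next
    fix f g :: "(nat \<times> 'i, 'i) quiver_mor" assume "Cod S f = Dom S g"
    then have fg: "target f = source g" by simp
    show "g \<cdot>\<^bsub>S\<^esub> f \<in> {f. closed_embedding True f}"
      if "f \<in> {f. closed_embedding True f}" "g \<in> {f. closed_embedding True f}"
      using that fg closed_embedding_comp by blast
    show "g \<cdot>\<^bsub>S\<^esub> f \<in> {f. closed_embedding False (dagger f)}"
      if "f \<in> {f. closed_embedding False (dagger f)}" "g \<in> {f. closed_embedding False (dagger f)}"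
      using that fg closed_embedding_comp[of False "dagger g" "dagger f"]
      by (simp add: dagger_comp del: Comp_S)
  next
    fix f :: "(nat \<times> 'i, 'i) quiver_mor" assume "is_iso S f"
    then show "f \<in> {f. closed_embedding True f} \<and> f \<in> {f. closed_embedding False (dagger f)}"
      by (simp add: closed_embedding_iso)
  next
    fix i i' j j' assume "i \<in> {f. closed_embedding True f}" "i' \<in> {f. closed_embedding True f}"
      "j \<in> {f. closed_embedding False (dagger f)}" "j' \<in> {f. closed_embedding False (dagger f)}"
      "commutative_square S i j i' j'"
    then show "cartesian S i j i' j' \<longleftrightarrow> cocartesian S i j i' j'"
      using cartesian_iff_cover cocartesian_iff_cover total surj by simp
  next
    fix i' j' assume "i' \<in> {f. closed_embedding True f}"
      "j' \<in> {f. closed_embedding False (dagger f)}" "Cod S i' = Cod S j'"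
    then show "\<exists>i\<in>{f. closed_embedding True f}. \<exists>j\<in>{f. closed_embedding False (dagger f)}.
        cartesian S i j i' j' \<and> cocartesian S i j i' j'"
      using closed_embedding_completion[of True i' j'] bicart by simp metis
  next
    fix i j assume i: "i \<in> {f. closed_embedding True f}"
      and j: "j \<in> {f. closed_embedding False (dagger f)}" and "Dom S i = Dom S j"
    then have dom: "source i = source j" by simp
    \<comment> \<open>A corner to be pushed out is, read backwards, a corner to be pulled back.\<close>
    obtain j'' i'' where *: "closed_embedding False j''" "closed_embedding True (dagger i'')"
      "commutative_square S j'' i'' (dagger j) (dagger i)"
      "Range (rel j'') \<union> Domain (rel (dagger i)) = pverts (target j'')"
    proof (rule closed_embedding_completion[of False "dagger j" "dagger i"])
      show "closed_embedding False (dagger j)" "closed_embedding (\<not> False) (dagger (dagger i))"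
        "target (dagger j) = target (dagger i)"
        using i j dom by simp_all
    qed (use that in simp)
    let ?i' = "dagger i''" and ?j' = "dagger j''"
    have sq: "commutative_square S i j ?i' ?j'"
      using commutative_square_dagger[of ?j' ?i' j i] *(3) by simp
    have "target i = target j''"
      using *(3) by (simp add: commutative_square_iff)
    then have "Range (rel i) \<union> Domain (rel ?j') = pverts (target i)"
      using *(4) by (simp add: Un_commute)
    then have "cartesian S i j ?i' ?j' \<and> cocartesian S i j ?i' ?j'"
      using bicart[OF _ _ _ _ sq] i j *(1,2) by simp
    then show "\<exists>i'\<in>{f. closed_embedding True f}. \<exists>j'\<in>{f. closed_embedding False (dagger f)}.
        cartesian S i j i' j' \<and> cocartesian S i j i' j'"
      using *(1,2) by (metis dagger_simps(4) mem_Collect_eq)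
  qed
qed

end


section \<open>Trees\<close>

definition sym_arcs :: "'i pair_pre_digraph \<Rightarrow> 'i rel" where
  "sym_arcs G = parcs G \<union> (parcs G)\<inverse>"

definition weakly_connected_on :: "'i pair_pre_digraph \<Rightarrow> 'i set \<Rightarrow> bool" where
  "weakly_connected_on G H \<longleftrightarrow> (\<forall>a\<in>H. \<forall>b\<in>H. (a, b) \<in> (sym_arcs G \<inter> H \<times> H)\<^sup>*)"

definition path_rel :: "'i pair_pre_digraph \<Rightarrow> 'i rel" where
  "path_rel G = {(a, b). quiver_le G b a}"

locale tree_quiver = finite_quiver +
  assumes no_cycle:
    "\<not> (\<exists>c. pre_digraph.cycle (with_proj (mk_symmetric (with_proj G))) c \<and> length c \<ge> 3)"
begin

text \<open>
  If \<open>y\<close> still reached \<open>x\<close> without the edge between them, a simple path doing so would have at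
  least two arcs, and the edge would close it to a cycle of length at least 3.
\<close>

lemma edge_is_bridge:
  assumes xy: "(x, y) \<in> sym_arcs G" "x \<noteq> y"
  shows "(y, x) \<notin> (sym_arcs G - {(x, y), (y, x)})\<^sup>*"
proof
  let ?E = "sym_arcs G - {(x, y), (y, x)}"
  let ?H = "\<lparr> pverts = pverts G, parcs = ?E \<rparr>"
  assume path: "(y, x) \<in> ?E\<^sup>*"
  interpret H: pair_wf_digraph ?H
    using arcs_in_verts by unfold_locales (auto simp: sym_arcs_def)
  have verts: "x \<in> pverts G" "y \<in> pverts G"
    using xy arcs_in_verts by (auto simp: sym_arcs_def)
  have E_verts: "?E \<subseteq> pverts G \<times> pverts G"
    using arcs_in_verts by (auto simp: sym_arcs_def)
  have "(y, z) \<in> rtrancl_on (pverts G) ?E" if "(y, z) \<in> ?E\<^sup>*" for z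
    using that
  proof (induction rule: rtrancl_induct)
    case base
    show ?case using verts(2) by (rule rtrancl_on_refl)
  next
    case (step z w)
    have "w \<in> pverts G" using step.hyps(2) E_verts by blast
    with step.IH step.hyps(2) show ?case by (rule rtrancl_on_into_rtrancl_on)
  qed
  then have "(y, x) \<in> rtrancl_on (pverts G) ?E"
    using path .
  then have "y \<rightarrow>\<^sup>*\<^bsub>with_proj ?H\<^esub> x"
    by (simp add: reachable_def)
  then obtain p where "H.apath y p x"
    using H.reachable_apath by blast
  then have p: "set p \<subseteq> ?E" "pcas y p x" "distinct (pawalk_verts y p)"
    by (auto simp: H.apath_def H.awalk_def)
  \<comment> \<open>The rule separates paths with no, exactly one, and at least two arcs; one arc would be the removed edge.\<close>
  have "length p \<ge> 2"
    using p(1,2) xy(2) by (cases p rule: remdups_adj.cases) auto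
  let ?c = "(x, y) # p"
  let ?M = "mk_symmetric (with_proj G)"
  have M: "parcs ?M = sym_arcs G" "pverts ?M = pverts G"
    by (auto simp: parcs_mk_symmetric sym_arcs_def)
  have "pre_digraph.cycle (with_proj ?M) ?c"
    unfolding pre_digraph.cycle_def pre_digraph.awalk_def cas_with_proj_eq awalk_verts_with_proj_eq
    using p xy verts by (intro exI[of _ x]) (auto simp: M)
  moreover have "length ?c \<ge> 3" using \<open>length p \<ge> 2\<close> by simp
  ultimately show False using no_cycle by blast
qed

text \<open>
  This is where paths of the whole quiver are reduced to arrows inside \<open>H\<close>.  Going backwards along the path from
  an end point outside \<open>J\<close>, suppose \<open>v \<rightarrow> w\<close> is the first step met that starts in \<open>J\<close>.
  By closedness \<open>w\<close> is not in \<open>H\<close>.  The rest of the path avoids \<open>J\<close>, hence avoids \<open>v\<close>, and the connected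
  set \<open>H\<close> joins \<open>b\<close> to \<open>v\<close> avoiding \<open>w\<close>.  So \<open>v\<close> and \<open>w\<close> stay connected without the edge between them.
\<close>

lemma closed_under_paths:
  assumes J: "J \<subseteq> H" "directed d (parcs G) `` J \<inter> H \<subseteq> J" and H: "weakly_connected_on G H"
    and path: "(a, b) \<in> (directed d (parcs G))\<^sup>*" and a: "a \<in> J" and b: "b \<in> H"
  shows "b \<in> J"
proof (rule ccontr)
  assume bJ: "b \<notin> J"
  let ?out = "sym_arcs G \<inter> (- J) \<times> (- J)"
  have "a \<notin> J \<and> (a, b) \<in> ?out\<^sup>*"
    using path
  proof (induction rule: converse_rtrancl_induct)
    case base
    show ?case using bJ by simp
  next
    case (step v w)
    have vw: "(v, w) \<in> sym_arcs G"
      using step(1) by (auto simp: directed_def sym_arcs_def split: if_splits)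
    have "v \<notin> J"
    proof
      assume v: "v \<in> J"
      then have w: "w \<notin> H" using step J by blast
      let ?E = "sym_arcs G - {(v, w), (w, v)}"
      have "(w, b) \<in> ?E\<^sup>*"
        by (rule rtrancl_mono[THEN subsetD, of ?out]) (use step.IH v in auto)
      also have "(b, v) \<in> (sym_arcs G \<inter> H \<times> H)\<^sup>*"
        using H b v J(1) by (auto simp: weakly_connected_on_def)
      then have "(b, v) \<in> ?E\<^sup>*"
        by (rule rtrancl_mono[THEN subsetD, rotated]) (use w in auto)
      finally show False
        using edge_is_bridge[OF vw] v step.IH by blast
    qed
    then show ?case
      using step.IH vw by (blast intro: converse_rtrancl_into_rtrancl)
  qed
  then show False using a by blast
qed

end


section \<open>Splitting an embedding into connected pieces\<close>

definition subquiver_inclusion ::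
  "'i pair_pre_digraph \<Rightarrow> 'i set \<Rightarrow> 'i set \<Rightarrow> ('i, 'i) quiver_mor" where
  "subquiver_inclusion G J H =
     \<lparr> source = full_subquiver G J, target = full_subquiver G H, rel = Id_on J \<rparr>"

lemma disjoint_union_inclusions:
  "disjoint_union_mor (map (\<lambda>(J, H). subquiver_inclusion G J H) ps) =
     \<lparr> source = layered_quiver G {(k, a). k < length ps \<and> a \<in> fst (ps ! k)},
       target = layered_quiver G {(k, a). k < length ps \<and> a \<in> snd (ps ! k)},
       rel = Id_on {(k, a). k < length ps \<and> a \<in> fst (ps ! k)} \<rparr>"
proof -
  have "map source (map (\<lambda>(J, H). subquiver_inclusion G J H) ps) = map (full_subquiver G) (map fst ps)"
    "map target (map (\<lambda>(J, H). subquiver_inclusion G J H) ps) = map (full_subquiver G) (map snd ps)"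
    by (auto simp: subquiver_inclusion_def)
  moreover have "{(k, a). k < length (map fst ps) \<and> a \<in> map fst ps ! k} = {(k, a). k < length ps \<and> a \<in> fst (ps ! k)}"
    "{(k, a). k < length (map snd ps) \<and> a \<in> map snd ps ! k} = {(k, a). k < length ps \<and> a \<in> snd (ps ! k)}"
    by auto
  moreover have "rel (map (\<lambda>(J, H). subquiver_inclusion G J H) ps ! k) = Id_on (fst (ps ! k))"
    if "k < length ps" for k
    using that by (simp add: split_beta subquiver_inclusion_def)
  then have "{((k, a), (l, b)). k = l \<and> k < length (map (\<lambda>(J, H). subquiver_inclusion G J H) ps) \<and>
      (a, b) \<in> rel (map (\<lambda>(J, H). subquiver_inclusion G J H) ps ! k)} =
    Id_on {(k, a). k < length ps \<and> a \<in> fst (ps ! k)}"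
    by auto
  ultimately show ?thesis
    unfolding disjoint_union_mor_def by (simp only: disjoint_union_layered)
qed

context finite_quiver
begin

text \<open>
  Listing the components turns an object into a disjoint union of connected full
  subquivers: a component lives in a single layer, where labels are injective.
\<close>

lemma connected_components:
  assumes "finite V"
  obtains Cs where "\<Union> (set Cs) = V"
    "\<And>i j x. i < length Cs \<Longrightarrow> j < length Cs \<Longrightarrow> x \<in> Cs ! i \<Longrightarrow> x \<in> Cs ! j \<Longrightarrow> i = j"
    "\<And>C x y. C \<in> set Cs \<Longrightarrow> x \<in> C \<Longrightarrow> (x, y) \<in> parcs (layered_quiver G V) \<Longrightarrow> y \<in> C"
    "\<And>C x y. C \<in> set Cs \<Longrightarrow> x \<in> C \<Longrightarrow> y \<in> C \<Longrightarrow> fst x = fst y"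
    "\<And>C. C \<in> set Cs \<Longrightarrow> weakly_connected_on G (snd ` C)"
proof -
  let ?A = "layered_quiver G V"
  define L where "L = parcs ?A \<union> (parcs ?A)\<inverse>"
  define R where "R = L\<^sup>* \<inter> V \<times> V"
  have LV: "L \<subseteq> V \<times> V" by (auto simp: L_def)
  have symL: "sym (L\<^sup>*)" by (rule sym_rtrancl) (auto simp: L_def sym_def)
  have equiv: "equiv V R"
  proof (rule equivI)
    show "R \<subseteq> V \<times> V" "refl_on V R"
      by (auto simp: R_def refl_on_def)
    show "sym R"
      unfolding R_def using symL by (rule sym_Int) (auto simp: sym_def)
    show "trans R"
      unfolding R_def using trans_rtrancl by (rule trans_Int) (auto simp: trans_def)
  qed
  have "finite (V // R)"
    using assms by (rule finite_quotient) (auto simp: R_def)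
  then obtain Cs where Cs: "set Cs = V // R" "distinct Cs"
    using finite_distinct_list by blast
  have inL: "(x, y) \<in> L\<^sup>*" if "C \<in> set Cs" "x \<in> C" "y \<in> C" for C x y
    using that equiv unfolding Cs by (metis IntD1 R_def quotient_eq_iff)
  have closed: "y \<in> C" if "C \<in> set Cs" "x \<in> C" "(x, y) \<in> L" for C x y
  proof -
    have "(x, y) \<in> R" using that(3) LV by (auto simp: R_def)
    then show ?thesis
      using that(1,2) equiv unfolding Cs
      by (meson in_quotient_imp_closed)
  qed
  show thesis
  proof (rule that)
    show "\<Union> (set Cs) = V"
      unfolding Cs using equiv by (rule Union_quotient)
    show "i = j" if "i < length Cs" "j < length Cs" "x \<in> Cs ! i" "x \<in> Cs ! j" for i j x
    proof -
      have "Cs ! i = Cs ! j"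
        using quotient_disj[OF equiv, of "Cs ! i" "Cs ! j"] that Cs(1) nth_mem by blast
      then show ?thesis using that(1,2) Cs(2) nth_eq_iff_index_eq by blast
    qed
    show "y \<in> C" if "C \<in> set Cs" "x \<in> C" "(x, y) \<in> parcs ?A" for C x y
      using closed[OF that(1,2)] that(3) by (simp add: L_def)
    show "fst x = fst y" if "C \<in> set Cs" "x \<in> C" "y \<in> C" for C x y
      using inL[OF that] by (induction rule: rtrancl_induct) (auto simp: L_def)
    show "weakly_connected_on G (snd ` C)" if C: "C \<in> set Cs" for C
    proof -
      have "(snd x, snd y) \<in> (sym_arcs G \<inter> snd ` C \<times> snd ` C)\<^sup>*" if "x \<in> C" "y \<in> C" for x y
      proof -
        have "y \<in> C \<and> (snd x, snd y) \<in> (sym_arcs G \<inter> snd ` C \<times> snd ` C)\<^sup>*"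
          using inL[OF C that]
        proof (induction rule: rtrancl_induct)
          case base
          show ?case using that by simp
        next
          case (step y z)
          then have "z \<in> C" using closed[OF C] by blast
          moreover have "(snd y, snd z) \<in> sym_arcs G"
            using step(2) by (auto simp: L_def sym_arcs_def)
          ultimately show ?case
            using step.IH by (auto intro: rtrancl_into_rtrancl)
        qed
        then show ?thesis by blast
      qed
      then show ?thesis by (auto simp: weakly_connected_on_def)
    qed
  qed
qed

text \<open>
  One summand is created for each connected component \<open>C\<close> of the target.  It includes the labels occurring in \<open>C\<close>
  and in the image of \<open>f\<close> into all labels occurring in \<open>C\<close>.  Passing to components is essential: within
  one given summand of the target, which may be disconnected, closedness under arrows need not give closedness
  under paths of the ambient quiver.  The direction \<open>d\<close> stays free in the last conclusion so that the same splitting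
  serves monomorphisms and epimorphisms.
\<close>

lemma total_morphism_splits:
  assumes f: "f \<in> Arr S" and total: "Domain (rel f) = pverts (source f)"
  obtains ps \<phi> \<psi> where "is_iso S \<phi>" "is_iso S \<psi>"
    "target \<phi> = source (disjoint_union_mor (map (\<lambda>(J, H). subquiver_inclusion G J H) ps))"
    "source \<psi> = target (disjoint_union_mor (map (\<lambda>(J, H). subquiver_inclusion G J H) ps))"
    "f = \<psi> \<cdot>\<^bsub>S\<^esub> disjoint_union_mor (map (\<lambda>(J, H). subquiver_inclusion G J H) ps) \<cdot>\<^bsub>S\<^esub> \<phi>"
    "\<And>J H. (J, H) \<in> set ps \<Longrightarrow> J \<subseteq> H \<and> H \<subseteq> pverts G \<and> weakly_connected_on G H"
    "\<And>d J H. (J, H) \<in> set ps \<Longrightarrow>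
       directed d (parcs (target f)) `` Range (rel f) \<subseteq> Range (rel f) \<Longrightarrow>
       directed d (parcs G) `` J \<inter> H \<subseteq> J"
proof -
  define T where "T = Range (rel f)"
  obtain V where V: "target f = layered_quiver G V" "finite V" "snd ` V \<subseteq> pverts G"
    using ArrD(2)[OF f] by (rule object_cases)
  have TV: "T \<subseteq> V" using ArrD(4)[OF f] V(1) by (auto simp: T_def)
  obtain Cs where cover: "\<Union> (set Cs) = V"
    and index: "\<And>i j x. i < length Cs \<Longrightarrow> j < length Cs \<Longrightarrow> x \<in> Cs ! i \<Longrightarrow> x \<in> Cs ! j \<Longrightarrow> i = j"
    and closed: "\<And>C x y. C \<in> set Cs \<Longrightarrow> x \<in> C \<Longrightarrow> (x, y) \<in> parcs (layered_quiver G V) \<Longrightarrow> y \<in> C"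
    and layer: "\<And>C x y. C \<in> set Cs \<Longrightarrow> x \<in> C \<Longrightarrow> y \<in> C \<Longrightarrow> fst x = fst y"
    and conn: "\<And>C. C \<in> set Cs \<Longrightarrow> weakly_connected_on G (snd ` C)"
    using connected_components[OF V(2)] by blast
  define ps where "ps = map (\<lambda>C. (snd ` (C \<inter> T), snd ` C)) Cs"
  define u where "u = disjoint_union_mor (map (\<lambda>(J, H). subquiver_inclusion G J H) ps)"
  define U where "U = {(k, a). k < length Cs \<and> a \<in> snd ` (Cs ! k \<inter> T)}"
  define U' where "U' = {(k, a). k < length Cs \<and> a \<in> snd ` (Cs ! k)}"
  have u: "u = \<lparr> source = layered_quiver G U, target = layered_quiver G U', rel = Id_on U \<rparr>"
  proof -
    have "{(k, a). k < length ps \<and> a \<in> fst (ps ! k)} = U"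
      "{(k, a). k < length ps \<and> a \<in> snd (ps ! k)} = U'"
      by (simp_all add: U_def U'_def ps_def cong: conj_cong)
    then show ?thesis unfolding u_def disjoint_union_inclusions by simp
  qed
  have UU': "U \<subseteq> U'" by (auto simp: U_def U'_def)
  have Cs_V: "Cs ! k \<subseteq> V" if "k < length Cs" for k
    using that cover by auto
  have U'_obj: "layered_quiver G U' \<in> subquiver_objects G"
  proof -
    have "U' \<subseteq> {..<length Cs} \<times> snd ` V"
      using Cs_V by (auto simp: U'_def)
    moreover from this have "finite U'"
      by (rule finite_subset) (simp add: V(2))
    ultimately show ?thesis using V(3) unfolding objects_eq by fastforce
  qed
  have U_obj: "layered_quiver G U \<in> subquiver_objects G"
    using U'_obj UU' by (rule object_restrict)
  \<comment> \<open>\<open>\<Psi>\<close> moves the vertices of the \<open>k\<close>-th component, without changing labels, back to their layer.\<close>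
  define \<Psi> where "\<Psi> = {(p, x). fst p < length Cs \<and> x \<in> Cs ! fst p \<and> snd p = snd x}"
  have \<Psi>_iff: "(p, x) \<in> \<Psi> \<longleftrightarrow> fst p < length Cs \<and> x \<in> Cs ! fst p \<and> snd p = snd x" for p x
    by (simp add: \<Psi>_def)
  have dom_\<Psi>: "Domain \<Psi> = U'"
  proof (rule Set.set_eqI)
    show "p \<in> Domain \<Psi> \<longleftrightarrow> p \<in> U'" for p
      by (cases p) (simp add: Domain_iff \<Psi>_iff U'_def image_iff Bex_def)
  qed
  have ran_\<Psi>: "Range \<Psi> = V"
  proof (rule equalityI; rule subsetI)
    fix x assume "x \<in> V"
    then obtain k where "k < length Cs" "x \<in> Cs ! k"
      using cover by (metis UnionE in_set_conv_nth)
    then have "((k, snd x), x) \<in> \<Psi>" by (simp add: \<Psi>_iff)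
    then show "x \<in> Range \<Psi>" by blast
  next
    fix x assume "x \<in> Range \<Psi>"
    then obtain p where "(p, x) \<in> \<Psi>" by blast
    then show "x \<in> V" using Cs_V by (auto simp: \<Psi>_iff)
  qed
  have U_iff: "p \<in> U \<longleftrightarrow> x \<in> T" if "(p, x) \<in> \<Psi>" for p x
  proof -
    have px: "fst p < length Cs" "x \<in> Cs ! fst p" "snd p = snd x"
      using that by (simp_all add: \<Psi>_iff)
    have "x' = x" if "x' \<in> Cs ! fst p" "snd x' = snd p" for x'
      using layer[OF nth_mem[OF px(1)] that(1) px(2)] that(2) px(3) by (simp add: prod_eq_iff)
    moreover have "p \<in> U \<longleftrightarrow> snd p \<in> snd ` (Cs ! fst p \<inter> T)"
      using px(1) by (cases p) (simp add: U_def)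
    ultimately show ?thesis
      using px(2,3) by (force intro!: rev_image_eqI)
  qed
  have \<Psi>: "\<Psi> \<in> partial_isos (layered_quiver G U') (target f)"
    unfolding V(1)
  proof (rule partial_isosI)
    show "\<Psi> \<subseteq> pverts (layered_quiver G U') \<times> pverts (layered_quiver G V)"
      using dom_\<Psi> ran_\<Psi> by auto
    show "single_valued \<Psi>"
    proof (rule single_valuedI)
      fix p x y assume "(p, x) \<in> \<Psi>" "(p, y) \<in> \<Psi>"
      then show "x = y"
        using layer[OF nth_mem, of "fst p" x y] by (simp add: \<Psi>_iff prod_eq_iff)
    qed
    show "single_valued (\<Psi>\<inverse>)"
    proof (rule single_valuedI)
      fix x p q assume "(x, p) \<in> \<Psi>\<inverse>" "(x, q) \<in> \<Psi>\<inverse>"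
      then show "p = q"
        using index[of "fst p" "fst q" x] by (simp add: \<Psi>_iff prod_eq_iff)
    qed
    fix p x assume px: "(p, x) \<in> \<Psi>"
    then have "p \<in> U'" "x \<in> V" using dom_\<Psi> ran_\<Psi> by auto
    then show "lab (layered_quiver G U') p = lab (layered_quiver G V) x"
      using px by (simp add: \<Psi>_iff)
    fix q y assume qy: "(q, y) \<in> \<Psi>"
    then have "q \<in> U'" "y \<in> V" using dom_\<Psi> ran_\<Psi> by auto
    have "fst p = fst q \<longleftrightarrow> fst x = fst y" if "(snd x, snd y) \<in> parcs G"
    proof
      assume "fst p = fst q"
      then show "fst x = fst y"
        using px qy layer[OF nth_mem, of "fst p" x y] by (simp add: \<Psi>_iff)
    next
      assume "fst x = fst y"
      then have "(x, y) \<in> parcs (layered_quiver G V)"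
        using \<open>x \<in> V\<close> \<open>y \<in> V\<close> that by simp
      then have "y \<in> Cs ! fst p"
        using px closed[OF nth_mem, of "fst p" x y] by (simp add: \<Psi>_iff)
      then show "fst p = fst q"
        using px qy index by (auto simp: \<Psi>_iff)
    qed
    then show "(p, q) \<in> parcs (layered_quiver G U') \<longleftrightarrow> (x, y) \<in> parcs (layered_quiver G V)"
      using px qy \<open>p \<in> U'\<close> \<open>q \<in> U'\<close> \<open>x \<in> V\<close> \<open>y \<in> V\<close> by (auto simp: \<Psi>_iff)
  qed
  define \<psi> where "\<psi> = \<lparr> source = layered_quiver G U', target = target f, rel = \<Psi> \<rparr>"
  have \<psi>: "is_iso S \<psi>"
    using \<Psi> dom_\<Psi> ran_\<Psi> U'_obj ArrD(2)[OF f] by (simp add: is_iso_iff \<psi>_def Arr_S V(1))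
  have u_Arr: "u \<in> Arr S"
    using U_obj U'_obj UU' by (simp add: u Arr_S Id_on_partial_isos_layered)
  \<comment> \<open>This is the only possible choice, since \<open>\<psi>\<close> is invertible and \<open>u\<close> is a monomorphism.\<close>
  define \<phi> where "\<phi> = dagger u \<cdot>\<^bsub>S\<^esub> (dagger \<psi> \<cdot>\<^bsub>S\<^esub> f)"
  have rel_\<phi>: "rel \<phi> = rel f O \<Psi>\<inverse> O Id_on U"
    by (simp add: \<phi>_def \<psi>_def u O_assoc)
  have U_T: "\<Psi>\<inverse> O Id_on U O \<Psi> = Id_on T"
  proof -
    have "Id_on U O \<Psi> = \<Psi> O Id_on T"
      using U_iff by blast
    then have "\<Psi>\<inverse> O Id_on U O \<Psi> = (\<Psi>\<inverse> O \<Psi>) O Id_on T"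
      by (simp only: O_assoc)
    also have "\<dots> = Id_on V O Id_on T"
      using converse_relcomp_Id_on[OF partial_isosD(2)[OF \<Psi>]] ran_\<Psi> by simp
    also have "\<dots> = Id_on T"
      using TV by (intro Id_on_relcomp) auto
    finally show ?thesis .
  qed
  have phi_iso: "is_iso S \<phi>"
    unfolding is_iso_iff
  proof (intro conjI)
    show "\<phi> \<in> Arr S"
      unfolding \<phi>_def using f u_Arr is_iso_Arr[OF \<psi>] by (intro Comp_Arr) (simp_all add: u \<psi>_def)
    have "x \<in> Domain (rel \<phi>)" if "(x, y) \<in> rel f" for x y
    proof -
      have "y \<in> T" using that by (auto simp: T_def)
      moreover from this obtain p where "(p, y) \<in> \<Psi>" using TV ran_\<Psi> by blast
      ultimately show ?thesis using that U_iff unfolding rel_\<phi> by blast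
    qed
    moreover have "Domain (rel \<phi>) \<subseteq> Domain (rel f)" unfolding rel_\<phi> by blast
    ultimately show "Domain (rel \<phi>) = pverts (source \<phi>)"
      using total by (simp add: \<phi>_def) blast
    have "p \<in> Range (rel \<phi>)" if "p \<in> U" for p
    proof -
      have "p \<in> Domain \<Psi>" using that UU' dom_\<Psi> by auto
      then obtain y where y: "(p, y) \<in> \<Psi>" by blast
      then have "y \<in> T" using that U_iff by blast
      then show ?thesis using y that unfolding rel_\<phi> T_def by blast
    qed
    moreover have "Range (rel \<phi>) \<subseteq> U" unfolding rel_\<phi> by blast
    ultimately show "Range (rel \<phi>) = pverts (target \<phi>)"
      by (simp add: \<phi>_def u) blast
  qed
  have f_eq: "f = \<psi> \<cdot>\<^bsub>S\<^esub> u \<cdot>\<^bsub>S\<^esub> \<phi>"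
  proof -
    have "rel \<phi> O Id_on U O \<Psi> = rel f O (\<Psi>\<inverse> O (Id_on U O Id_on U) O \<Psi>)"
      unfolding rel_\<phi> by (simp only: O_assoc)
    also have "Id_on U O Id_on U = Id_on U" by (rule relcomp_Id_on) auto
    also have "rel f O (\<Psi>\<inverse> O Id_on U O \<Psi>) = rel f"
      unfolding U_T T_def by (rule relcomp_Id_on) simp
    finally show ?thesis
      by (simp add: \<phi>_def \<psi>_def u O_assoc)
  qed
  have ps_connected: "J \<subseteq> H \<and> H \<subseteq> pverts G \<and> weakly_connected_on G H" if "(J, H) \<in> set ps" for J H
    using that conn cover V(3) by (auto simp: ps_def)
  have ps_closed: "directed d (parcs G) `` J \<inter> H \<subseteq> J"
    if JH: "(J, H) \<in> set ps" and T: "directed d (parcs (target f)) `` Range (rel f) \<subseteq> Range (rel f)"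
    for d J H
  proof
    fix b assume "b \<in> directed d (parcs G) `` J \<inter> H"
    moreover obtain C where C: "C \<in> set Cs" "J = snd ` (C \<inter> T)" "H = snd ` C"
      using JH by (auto simp: ps_def)
    ultimately obtain x y where xy: "x \<in> C" "x \<in> T" "y \<in> C" "b = snd y"
      "(snd x, snd y) \<in> directed d (parcs G)"
      by auto
    have "fst x = fst y" using layer[OF C(1)] xy by blast
    moreover have "x \<in> V" "y \<in> V" using xy C(1) cover by auto
    ultimately have "(x, y) \<in> directed d (parcs (target f))"
      unfolding V(1) directed_parcs_layered using xy(5) by simp
    then have "y \<in> T" using T xy(2) by (auto simp: T_def)
    then show "b \<in> J" using xy C by blast
  qed
  have ends: "target \<phi> = source u" "source \<psi> = target u"
    by (simp_all add: \<phi>_def \<psi>_def u)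
  show thesis
    by (rule that[of \<phi> \<psi> ps, folded u_def])
      (fact phi_iso \<psi> ends f_eq ps_connected ps_closed)+
qed

end


section \<open>Admissible morphisms are closed embeddings and their duals\<close>

definition basic_embeddings :: "bool \<Rightarrow> 'i pair_pre_digraph \<Rightarrow> ('i, 'i) quiver_mor set" where
  "basic_embeddings d G =
     {subquiver_inclusion G J H | J H. J \<subseteq> H \<and> H \<subseteq> pverts G \<and> directed d (path_rel G) `` J \<inter> H \<subseteq> J}"

lemma directed_path_rel_closed_iff:
  "directed True (path_rel G) `` J \<inter> H \<subseteq> J \<longleftrightarrow> (\<forall>a\<in>J. {b \<in> H. quiver_le G b a} \<subseteq> J)"
  "directed False (path_rel G) `` J \<inter> H \<subseteq> J \<longleftrightarrow> (\<forall>a\<in>J. {b \<in> H. quiver_le G a b} \<subseteq> J)"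
  unfolding directed_def path_rel_def by auto

lemma basic_admissible_monos_eq: "basic_admissible_monos G = basic_embeddings True G"
  unfolding basic_admissible_monos_def basic_embeddings_def subquiver_inclusion_def
    directed_path_rel_closed_iff ..

lemma basic_admissible_epis_eq: "basic_admissible_epis G = dagger ` basic_embeddings False G"
proof -
  have "dagger ` basic_embeddings False G = {dagger (subquiver_inclusion G K H) | H K.
      K \<subseteq> H \<and> H \<subseteq> pverts G \<and> directed False (path_rel G) `` K \<inter> H \<subseteq> K}"
    unfolding basic_embeddings_def by blast
  then show ?thesis
    unfolding basic_admissible_epis_def directed_path_rel_closed_iff
    by (simp add: subquiver_inclusion_def dagger_def)
qed

lemma disjoint_union_mor_dagger:
  "disjoint_union_mor (map dagger fs) = dagger (disjoint_union_mor fs)"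
proof -
  have "map source (map dagger fs) = map target fs" "map target (map dagger fs) = map source fs"
    by simp_all
  then show ?thesis
    unfolding disjoint_union_mor_def dagger_def by (simp only: quiver_mor.simps) auto
qed

context finite_quiver
begin

lemma unions_dagger: "unions_up_to_iso G (dagger ` F) = dagger ` unions_up_to_iso G F"
proof -
  have sub: "dagger ` unions_up_to_iso G F \<subseteq> unions_up_to_iso G (dagger ` F)" for F
  proof
    fix g assume "g \<in> dagger ` unions_up_to_iso G F"
    then obtain \<phi> fs \<psi> where g: "g = dagger (\<psi> \<cdot>\<^bsub>S\<^esub> disjoint_union_mor fs \<cdot>\<^bsub>S\<^esub> \<phi>)"
      and *: "set fs \<subseteq> F" "is_iso S \<phi>" "is_iso S \<psi>"
        "Cod S \<phi> = source (disjoint_union_mor fs)" "Dom S \<psi> = target (disjoint_union_mor fs)"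
      unfolding unions_up_to_iso_def Let_def by blast
    have "g = dagger \<phi> \<cdot>\<^bsub>S\<^esub> disjoint_union_mor (map dagger fs) \<cdot>\<^bsub>S\<^esub> dagger \<psi>"
      unfolding g disjoint_union_mor_dagger dagger_comp by (simp add: O_assoc)
    moreover have "set (map dagger fs) \<subseteq> dagger ` F"
      using *(1) by auto
    moreover have "is_iso S (dagger \<psi>)" "is_iso S (dagger \<phi>)"
      using *(2,3) by simp_all
    moreover have "Cod S (dagger \<psi>) = source (disjoint_union_mor (map dagger fs))"
      "Dom S (dagger \<phi>) = target (disjoint_union_mor (map dagger fs))"
      using *(4,5) by (simp_all add: disjoint_union_mor_dagger)
    ultimately show "g \<in> unions_up_to_iso G (dagger ` F)"
      unfolding unions_up_to_iso_def Let_def by blast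
  qed
  have "unions_up_to_iso G (dagger ` F) = dagger ` dagger ` unions_up_to_iso G (dagger ` F)"
    by (simp add: image_image)
  also have "\<dots> \<subseteq> dagger ` unions_up_to_iso G (dagger ` dagger ` F)"
    using sub by (intro image_mono)
  also have "dagger ` dagger ` F = F" by (simp add: image_image)
  finally show ?thesis using sub by blast
qed

lemma arcs_subset_path_rel: "parcs G \<subseteq> path_rel G"
proof -
  interpret pair_wf_digraph G
    using arcs_in_verts by unfold_locales auto
  show ?thesis
    by (auto simp: path_rel_def quiver_le_def intro!: reachable_adjI)
qed

lemma path_rel_subset: "path_rel G \<subseteq> (parcs G)\<^sup>*"
proof
  fix e assume "e \<in> path_rel G"
  then obtain a b where "e = (a, b)" "a \<rightarrow>\<^sup>*\<^bsub>with_proj G\<^esub> b"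
    by (auto simp: path_rel_def quiver_le_def)
  then show "e \<in> (parcs G)\<^sup>*"
    by (auto simp: reachable_def dest: rtrancl_on_rtranclI)
qed

lemma directed_mono: "E \<subseteq> E' \<Longrightarrow> directed d E \<subseteq> directed d E'"
  by (auto simp: directed_def)

lemma directed_rtrancl: "directed d (E\<^sup>*) = (directed d E)\<^sup>*"
  by (simp add: directed_def rtrancl_converse)

text \<open>
  Each arrow is a path, so closure under paths in every summand gives closure under the arrows of the union.
\<close>

lemma closed_embedding_basic_union:
  assumes "set fs \<subseteq> basic_embeddings d G"
  shows "closed_embedding d (disjoint_union_mor fs)"
proof -
  have "\<forall>f\<in>set fs. \<exists>p. f = (\<lambda>(J, H). subquiver_inclusion G J H) p \<and> fst p \<subseteq> snd p \<and>
      snd p \<subseteq> pverts G \<and> directed d (path_rel G) `` fst p \<inter> snd p \<subseteq> fst p"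
    using assms by (force simp: basic_embeddings_def)
  then obtain P where P: "\<And>f. f \<in> set fs \<Longrightarrow> f = (\<lambda>(J, H). subquiver_inclusion G J H) (P f) \<and>
      fst (P f) \<subseteq> snd (P f) \<and> snd (P f) \<subseteq> pverts G \<and>
      directed d (path_rel G) `` fst (P f) \<inter> snd (P f) \<subseteq> fst (P f)"
    by metis
  define ps where "ps = map P fs"
  have fs: "fs = map (\<lambda>(J, H). subquiver_inclusion G J H) ps"
    unfolding ps_def map_map comp_def using P by (metis (no_types, lifting) map_idI)
  have ps: "fst (ps ! k) \<subseteq> snd (ps ! k)" "snd (ps ! k) \<subseteq> pverts G"
    "directed d (path_rel G) `` fst (ps ! k) \<inter> snd (ps ! k) \<subseteq> fst (ps ! k)" if "k < length ps" for k
    using P[of "fs ! k"] that by (auto simp: ps_def)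
  define U where "U = {(k, a). k < length ps \<and> a \<in> fst (ps ! k)}"
  define U' where "U' = {(k, a). k < length ps \<and> a \<in> snd (ps ! k)}"
  have u: "disjoint_union_mor fs = \<lparr> source = layered_quiver G U, target = layered_quiver G U', rel = Id_on U \<rparr>"
    unfolding fs disjoint_union_inclusions U_def U'_def ..
  have UU': "U \<subseteq> U'" using ps(1) by (auto simp: U_def U'_def)
  have "U' \<subseteq> {..<length ps} \<times> pverts G"
    using ps(2) by (auto simp: U'_def)
  then have "finite U'" "snd ` U' \<subseteq> pverts G"
    using finite_subset[of U' "{..<length ps} \<times> pverts G"] finite_verts by auto
  then have U'_obj: "layered_quiver G U' \<in> subquiver_objects G"
    unfolding objects_eq by auto
  then have U_obj: "layered_quiver G U \<in> subquiver_objects G"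
    using UU' by (rule object_restrict)
  have "y \<in> U" if xU: "x \<in> U" and xy: "(x, y) \<in> directed d (parcs (layered_quiver G U'))" for x y
  proof -
    obtain k a b where x: "x = (k, a)" and y: "y = (k, b)"
      using xy unfolding directed_parcs_layered by (cases x; cases y) auto
    have "k < length ps" "a \<in> fst (ps ! k)" "b \<in> snd (ps ! k)"
      using xU xy unfolding directed_parcs_layered x y by (auto simp: U_def U'_def)
    moreover have "(a, b) \<in> directed d (path_rel G)"
      using xy directed_mono[OF arcs_subset_path_rel, of d]
      unfolding directed_parcs_layered x y by auto
    ultimately show ?thesis using ps(3) unfolding U_def y by blast
  qed
  then show ?thesis
    using U_obj U'_obj UU' unfolding closed_embedding_def u
    by (auto simp: Arr_S Id_on_partial_isos_layered)
qed

end

context tree_quiver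
begin

lemma unions_of_basic_embeddings:
  "unions_up_to_iso G (basic_embeddings d G) = {f. closed_embedding d f}"
proof (intro equalityI subsetI)
  fix f assume "f \<in> unions_up_to_iso G (basic_embeddings d G)"
  then obtain \<phi> fs \<psi> where f: "f = \<psi> \<cdot>\<^bsub>S\<^esub> disjoint_union_mor fs \<cdot>\<^bsub>S\<^esub> \<phi>"
    and fs: "set fs \<subseteq> basic_embeddings d G" and iso: "is_iso S \<phi>" "is_iso S \<psi>"
    and "Cod S \<phi> = source (disjoint_union_mor fs)" "Dom S \<psi> = target (disjoint_union_mor fs)"
    unfolding unions_up_to_iso_def Let_def by blast
  then have eq: "target \<phi> = source (disjoint_union_mor fs)" "target (disjoint_union_mor fs) = source \<psi>"
    by simp_all
  have "closed_embedding d (\<psi> \<cdot>\<^bsub>S\<^esub> disjoint_union_mor fs)"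
    using closed_embedding_basic_union[OF fs] closed_embedding_iso[OF iso(2)] eq(2)
    by (rule closed_embedding_comp)
  with closed_embedding_iso[OF iso(1)] have "closed_embedding d f"
    unfolding f by (rule closed_embedding_comp) (simp add: eq(1))
  then show "f \<in> {f. closed_embedding d f}" by simp
next
  fix f assume "f \<in> {f. closed_embedding d f}"
  then have f: "f \<in> Arr S" "Domain (rel f) = pverts (source f)"
    and closed: "directed d (parcs (target f)) `` Range (rel f) \<subseteq> Range (rel f)"
    by (auto simp: closed_embedding_def)
  obtain ps \<phi> \<psi> where iso: "is_iso S \<phi>" "is_iso S \<psi>"
    and dom: "target \<phi> = source (disjoint_union_mor (map (\<lambda>(J, H). subquiver_inclusion G J H) ps))"
    and cod: "source \<psi> = target (disjoint_union_mor (map (\<lambda>(J, H). subquiver_inclusion G J H) ps))"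
    and eq: "f = \<psi> \<cdot>\<^bsub>S\<^esub> disjoint_union_mor (map (\<lambda>(J, H). subquiver_inclusion G J H) ps) \<cdot>\<^bsub>S\<^esub> \<phi>"
    and ps: "\<And>J H. (J, H) \<in> set ps \<Longrightarrow> J \<subseteq> H \<and> H \<subseteq> pverts G \<and> weakly_connected_on G H"
    and ps_closed: "\<And>d J H. (J, H) \<in> set ps \<Longrightarrow>
       directed d (parcs (target f)) `` Range (rel f) \<subseteq> Range (rel f) \<Longrightarrow>
       directed d (parcs G) `` J \<inter> H \<subseteq> J"
    by (rule total_morphism_splits[OF f], rule that, assumption+)
  have "subquiver_inclusion G J H \<in> basic_embeddings d G" if JH: "(J, H) \<in> set ps" for J H
  proof -
    have "b \<in> J" if "(a, b) \<in> directed d (path_rel G)" "a \<in> J" "b \<in> H" for a b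
    proof (rule closed_under_paths)
      show "(a, b) \<in> (directed d (parcs G))\<^sup>*"
        using that(1) directed_mono[OF path_rel_subset, of d] directed_rtrancl by blast
    qed (use ps[OF JH] ps_closed[OF JH closed] that in auto)
    then show ?thesis
      using ps[OF JH] unfolding basic_embeddings_def by blast
  qed
  then have "set (map (\<lambda>(J, H). subquiver_inclusion G J H) ps) \<subseteq> basic_embeddings d G"
    by auto
  then show "f \<in> unions_up_to_iso G (basic_embeddings d G)"
    unfolding unions_up_to_iso_def Let_def mem_Collect_eq
    using iso dom cod eq by (intro exI conjI) simp_all
qed

text \<open>
  Taking daggers commutes with forming disjoint unions and with adjusting by isomorphisms, so the
  description of the monomorphisms carries over to the epimorphisms.
\<close>

proposition proto_exact_admissible: "proto_exact S (admissible_monos G) (admissible_epis G)"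
proof -
  have "admissible_monos G = {f. closed_embedding True f}"
    by (simp add: admissible_monos_def basic_admissible_monos_eq unions_of_basic_embeddings)
  moreover have "admissible_epis G = {f. closed_embedding False (dagger f)}"
  proof -
    have "admissible_epis G = dagger ` {f. closed_embedding False f}"
      by (simp add: admissible_epis_def basic_admissible_epis_eq unions_dagger unions_of_basic_embeddings)
    also have "\<dots> = {f. closed_embedding False (dagger f)}"
      by (auto simp: image_iff) (metis dagger_simps(4))
    finally show ?thesis .
  qed
  ultimately show ?thesis using proto_exact_closed_embeddings by simp
qed

end

theorem theorem3p19:
  fixes W :: "('w, 'x) monoid_scheme" and s :: "'n::finite \<Rightarrow> 'w"
    and Q :: "'n list" and p :: 'w and I :: "nat set"
  assumes "quadruple W s Q p I"
    and "irreducible_quadruple W s Q I"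
    and "root_independent W s Q I"
    and "underlying_tree (root_quiver W s Q I)"
  shows "proto_exact (subquiver_category (root_quiver W s Q I))
           (admissible_monos (root_quiver W s Q I)) (admissible_epis (root_quiver W s Q I))"
proof -
  have "I \<subseteq> {..<length Q}"
    using assms(1) by (auto simp: quadruple_def subword_complex_def)
  then have "finite I" by (rule finite_subset) simp
  then interpret tree_quiver "root_quiver W s Q I"
    using assms(4) by unfold_locales (auto simp: root_quiver_def underlying_tree_def)
  show ?thesis by (rule proto_exact_admissible)
qed

end
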